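(* Let $\mathcal L_n$ be the number of men (equivalently, of women) matched in every stable (possibly partial) matching in the random model with $n$ men, $n$ women, independent uniformly random complete preference lists, and independent admissibility of each pair with probability $p=p(n)\in(0,1)$. Let $\Delta>0$ and $c$ be constants. If $p(n)\ge c\,\frac{\log^2 n}{n}$ and $c>\bigl(1+\frac{1}{2\Delta}\bigr)^2$, then $$\mathbb{P}(\mathcal L_n\le n-\Delta)\to 0\qquad (n\to\infty).$$ Consequently, if $p(n)\ge c\,\frac{\log^2 n}{n}$ with a constant $c>1$, then the number $n-\mathcal L_n$ of unmatched men (and of unmatched women) is bounded in probability. In particular, if $p(n)\ge c\,\frac{\log^2 n}{n}$ with a constant $c>\frac94$, then $\mathbb{P}(\mathcal L_n=n)\to 1$.
   Context: Model. There are $n$ men and $n$ women. Each man has a preference list which is a permutation (strict linear order) of all $n$ women, and each woman has a preference list which is a permutation of all $n$ men; the $2n$ lists are independent and uniformly random. Independently of the lists, each of the $n^2$ pairs (man, woman) is admissible with probability $p=p(n)$, independently of all other pairs. A (possibly partial) matching $M$ is a set of pairwise disjoint admissible pairs (man, woman). It is called stable if there is no admissible pair $(m,w)\notin M$ such that both: $m$ is unmatched in $M$ or prefers $w$ to his partner in $M$; and $w$ is unmatched in $M$ or prefers $m$ to her partner in $M$. A stable matching always exists, and (Gusfield and Irving) all stable matchings of a given instance match the same set of men and the same set of women. $\mathcal L_n$ denotes the common size (number of pairs) of the stable matchings; $\mathcal L_n=n$ means that a complete stable matching exists. Inequalities on $p(n)$ are understood to hold for all sufficiently large $n$; $\log$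 is the natural logarithm. *)

theory Defs
  imports "HOL-Probability.Probability" "HOL-Combinatorics.Multiset_Permutations"
begin

(* Men and women are both labelled by {..<n}; a pair (m, w) is (man, woman).  An instance consists
   of the men's preference lists, the women's preference lists (most preferred first) and the
   admissibility predicate on pairs. *)

type_synonym sm_instance = "(nat \<Rightarrow> nat list) \<times> (nat \<Rightarrow> nat list) \<times> (nat \<times> nat \<Rightarrow> bool)"

definition prefers :: "nat list \<Rightarrow> nat \<Rightarrow> nat \<Rightarrow> bool" where
  "prefers l x y \<longleftrightarrow> (\<exists>i j. i < j \<and> j < length l \<and> l ! i = x \<and> l ! j = y)"

definition matching :: "nat \<Rightarrow> sm_instance \<Rightarrow> (nat \<times> nat) set \<Rightarrow> bool" where
  "matching n = (\<lambda>(mp, wp, adm) M.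
     M \<subseteq> {..<n} \<times> {..<n} \<and> (\<forall>e\<in>M. adm e) \<and>
     (\<forall>e\<in>M. \<forall>e'\<in>M. fst e = fst e' \<or> snd e = snd e' \<longrightarrow> e = e'))"

definition blocks :: "nat \<Rightarrow> sm_instance \<Rightarrow> (nat \<times> nat) set \<Rightarrow> nat \<times> nat \<Rightarrow> bool" where
  "blocks n = (\<lambda>(mp, wp, adm) M (m, w).
     m < n \<and> w < n \<and> adm (m, w) \<and> (m, w) \<notin> M \<and>
     (m \<notin> fst ` M \<or> (\<exists>w'. (m, w') \<in> M \<and> prefers (mp m) w w')) \<and>
     (w \<notin> snd ` M \<or> (\<exists>m'. (m', w) \<in> M \<and> prefers (wp w) m m')))"

definition stable_matching :: "nat \<Rightarrow> sm_instance \<Rightarrow> (nat \<times> nat) set \<Rightarrow> bool" where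
  "stable_matching n I M \<longleftrightarrow> matching n I M \<and> \<not> (\<exists>e. blocks n I M e)"

(* The description is proper whenever all preference lists are permutations of {..<n}, hence almost
   surely in the model below: a stable matching exists, and all stable matchings match the same men
   and the same women (Gusfield and Irving). *)
definition stable_size :: "nat \<Rightarrow> sm_instance \<Rightarrow> nat" where
  "stable_size n I = (THE k. \<exists>M. stable_matching n I M \<and> card M = k)"

(* Outside of {..<n}, respectively {..<n} \<times> {..<n}, the components take the irrelevant
   default values [] and False. *)
definition sm_model :: "nat \<Rightarrow> real \<Rightarrow> sm_instance pmf" where
  "sm_model n p =
     pair_pmf (Pi_pmf {..<n} [] (\<lambda>_. pmf_of_set (permutations_of_set {..<n})))
       (pair_pmf (Pi_pmf {..<n} [] (\<lambda>_. pmf_of_set (permutations_of_set {..<n})))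
         (Pi_pmf ({..<n} \<times> {..<n}) False (\<lambda>_. bernoulli_pmf p)))"

definition bounded_in_probability :: "(nat \<Rightarrow> 'a pmf) \<Rightarrow> (nat \<Rightarrow> 'a \<Rightarrow> real) \<Rightarrow> bool" where
  "bounded_in_probability D X \<longleftrightarrow>
     (\<forall>\<epsilon>>0. \<exists>K. \<forall>n. measure_pmf.prob (D n) {x. \<bar>X n x\<bar> > K} \<le> \<epsilon>)"

end

theory Submission
  imports Defs "HOL-Real_Asymp.Real_Asymp"
begin

text \<open>
  The proof is a first moment estimate for the number of stable matchings that leave \<open>k\<close> men and
  \<open>k\<close> women single. The set of women whom a man prefers to his partner is distributed like a random
  set that contains each other woman independently with probability \<open>x\<close>, for \<open>x\<close> uniform on the
  unit interval. Averaging over the lists therefore turns the probability that a fixed matching of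
  size \<open>m = n - k\<close> is stable into an integral of products of factors \<open>1 - p x\<^sub>i y\<^sub>j\<close>, where
  \<open>x\<^sub>i = 1\<close> and \<open>y\<^sub>j = 1\<close> for the unmatched agents. Integrating out all
  \<open>x\<^sub>i\<close> and writing the resulting negative power of \<open>k + \<Sum> y\<^sub>j\<close> as a Gamma integral over \<open>u\<close>
  leaves, up to a constant, the integral over \<open>u \<ge> 0\<close> of
  \<open>(1 - p)^(k^2) u^(m-1) e^(-ku) / ((m-1)! (u + pk)^m)\<close>. Here
  \<open>(u / (u + pk))^(m-1) \<le> exp (- (m-1) p k / (u + pk))\<close>, and the inequality of arithmetic and geometric
  means bounds the exponential part by \<open>exp (p k^2 - 2 k sqrt ((m-1) p))\<close>, whose first term cancels
  against \<open>(1 - p)^(k^2)\<close>. There are \<open>(n choose k)^2 m!\<close> matchings of size \<open>m\<close>, so for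
  \<open>p = c (ln n)^2 / n\<close> the expectation is about \<open>n^(2k + 1 - 2k sqrt c)\<close>.
\<close>

subsection \<open>Existence and size of stable matchings\<close>

lemma prefers_asym: "distinct l \<Longrightarrow> prefers l x y \<Longrightarrow> \<not> prefers l y x"
  unfolding prefers_def by (metis dual_order.strict_trans less_asym nth_eq_iff_index_eq)

lemma prefers_total: "x \<in> set l \<Longrightarrow> y \<in> set l \<Longrightarrow> x \<noteq> y \<Longrightarrow> prefers l x y \<or> prefers l y x"
  unfolding prefers_def in_set_conv_nth by (metis linorder_neqE_nat)

lemma most_preferred_exists:
  assumes "X \<subseteq> set l" "X \<noteq> {}"
  obtains x where "x \<in> X" "\<And>y. y \<in> X \<Longrightarrow> y \<noteq> x \<Longrightarrow> prefers l x y"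
proof -
  define P where "P i \<longleftrightarrow> i < length l \<and> l ! i \<in> X" for i
  have "\<exists>i. P i"
    using assms unfolding P_def by (metis ex_in_conv in_set_conv_nth subset_iff)
  then have P: "P (Least P)" and least: "\<And>j. P j \<Longrightarrow> Least P \<le> j"
    by (auto intro: LeastI_ex Least_le)
  show ?thesis
  proof
    show "l ! Least P \<in> X"
      using P by (simp add: P_def)
    fix y assume y: "y \<in> X" "y \<noteq> l ! Least P"
    then obtain j where j: "j < length l" "l ! j = y"
      using assms by (metis in_set_conv_nth subset_iff)
    then have "Least P \<le> j" "j \<noteq> Least P"
      using y least[of j] by (auto simp: P_def)
    then show "prefers l (l ! Least P) y"
      using j unfolding prefers_def by (metis le_neq_implies_less)
  qed
qed

definition proper_prefs :: "nat \<Rightarrow> (nat \<Rightarrow> nat list) \<Rightarrow> bool" where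
  "proper_prefs n mp \<longleftrightarrow> (\<forall>i<n. mp i \<in> permutations_of_set {..<n})"

lemma proper_prefsD:
  assumes "proper_prefs n mp" "i < n"
  shows "distinct (mp i)" "set (mp i) = {..<n}"
  using assms by (auto simp: proper_prefs_def permutations_of_set_def)

text \<open>With X the pairs available to the men and Y those available to the women, a stable matching
  is the common choice of both sides at a fixed point of the monotone map below.\<close>

lemma stable_matching_exists:
  assumes "proper_prefs n mp" "proper_prefs n wp"
  shows "\<exists>M. stable_matching n (mp, wp, adm) M"
proof -
  define E where "E = {(m, w). m < n \<and> w < n \<and> adm (m, w)}"
  \<comment> \<open>\<open>RM X\<close> and \<open>RW X\<close> collect the pairs of
    \<open>X\<close> rejected by their man, respectively by their woman, because \<open>X\<close>
    offers someone better.\<close>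
  define RM where "RM X = {(m, w) \<in> X. \<exists>w'. (m, w') \<in> X \<and> prefers (mp m) w' w}" for X
  define RW where "RW X = {(m, w) \<in> X. \<exists>m'. (m', w) \<in> X \<and> prefers (wp w) m' m}" for X
  define F where "F X = E - RW (E - RM X)" for X
  have RM_mono: "RM X \<subseteq> RM X'" if "X \<subseteq> X'" for X X'
    unfolding RM_def using that by blast
  have RW_mono: "RW X \<subseteq> RW X'" if "X \<subseteq> X'" for X X'
    unfolding RW_def using that by blast
  \<comment> \<open>The argument occurs under two complements, so the two order reversals
    cancel.\<close>
  have "mono F"
    unfolding F_def by (intro monoI Diff_mono order_refl RW_mono RM_mono)
  define X where "X = lfp F"
  define Y where "Y = E - RM X"
  have X: "X = E - RW Y"
    using lfp_unfold[OF \<open>mono F\<close>] by (simp add: X_def Y_def F_def)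
  define M where "M = X \<inter> Y"
  have subE: "X \<subseteq> E" "Y \<subseteq> E" "M \<subseteq> E"
    using X Y_def M_def by blast+
  \<comment> \<open>Men choosing from \<open>X\<close> and women choosing from \<open>Y\<close> thus
    arrive at the same set of pairs. This description makes a woman unique for each man, the next
    one a man unique for each woman.\<close>
  have MX: "M = X - RM X"
    using subE by (auto simp: M_def Y_def)
  have MY: "M = Y - RW Y"
    using X subE by (auto simp: M_def)
  have uniq1: "w = w'" if "(m, w) \<in> M" "(m, w') \<in> M" for m w w'
  proof (rule ccontr)
    assume "w \<noteq> w'"
    moreover have "m < n" "w < n" "w' < n"
      using that subE by (auto simp: E_def)
    ultimately have "prefers (mp m) w w' \<or> prefers (mp m) w' w"
      using prefers_total proper_prefsD[OF assms(1)] by blast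
    then show False
      using that unfolding MX RM_def by blast
  qed
  have uniq2: "m = m'" if "(m, w) \<in> M" "(m', w) \<in> M" for m m' w
  proof (rule ccontr)
    assume "m \<noteq> m'"
    moreover have "w < n" "m < n" "m' < n"
      using that subE by (auto simp: E_def)
    ultimately have "prefers (wp w) m m' \<or> prefers (wp w) m' m"
      using prefers_total proper_prefsD[OF assms(2)] by blast
    then show False
      using that unfolding MY RW_def by blast
  qed
  have "matching n (mp, wp, adm) M"
  proof -
    have "M \<subseteq> {..<n} \<times> {..<n}" "\<forall>e\<in>M. adm e"
      using subE by (auto simp: E_def)
    moreover have "\<forall>e\<in>M. \<forall>e'\<in>M. fst e = fst e' \<or> snd e = snd e' \<longrightarrow> e = e'"
      by (metis prod.collapse uniq1 uniq2)
    ultimately show ?thesis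
      by (simp add: matching_def)
  qed
  moreover have "\<not> blocks n (mp, wp, adm) M (m, w)" for m w
  proof
    assume bl: "blocks n (mp, wp, adm) M (m, w)"
    then have b: "m < n" "w < n" "(m, w) \<in> E" "(m, w) \<notin> M"
      and bm: "m \<notin> fst ` M \<or> (\<exists>w'. (m, w') \<in> M \<and> prefers (mp m) w w')"
      and bw: "w \<notin> snd ` M \<or> (\<exists>m'. (m', w) \<in> M \<and> prefers (wp w) m m')"
      by (simp_all add: blocks_def E_def)
    \<comment> \<open>A pair of \<open>E\<close> outside \<open>M\<close> is missing from
      \<open>Y\<close>, hence rejected in \<open>X\<close> by its man, or missing from
      \<open>X\<close>, hence rejected in \<open>Y\<close> by its woman.\<close>
    then consider "(m, w) \<in> RM X" | "(m, w) \<in> RW Y"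
      using X Y_def M_def by blast
    then show False
    proof cases
      case 1
      \<comment> \<open>The favourite \<open>v\<close> of \<open>m\<close> among his options in
        \<open>X\<close> is his partner in \<open>M\<close>, so \<open>m\<close> cannot prefer
        \<open>w\<close>. The other case is symmetric.\<close>
      have "{w'. (m, w') \<in> X} \<subseteq> set (mp m)"
        using subE proper_prefsD[OF assms(1) b(1)] by (auto simp: E_def)
      moreover have wX: "(m, w) \<in> X"
        using 1 by (simp add: RM_def)
      ultimately obtain v where v: "(m, v) \<in> X" "\<And>y. (m, y) \<in> X \<Longrightarrow> y \<noteq> v \<Longrightarrow> prefers (mp m) v y"
        using most_preferred_exists[of "{w'. (m, w') \<in> X}" "mp m"] by (metis wX empty_iff mem_Collect_eq)
      have "(m, v) \<notin> RM X"
        using v prefers_asym[OF proper_prefsD(1)[OF assms(1) b(1)]] unfolding RM_def by blast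
      then have vM: "(m, v) \<in> M"
        using v MX by blast
      then have "prefers (mp m) w v"
        using bm uniq1 by (metis fst_conv image_eqI)
      moreover have "prefers (mp m) v w"
        using v(2)[of w] wX vM b(4) by blast
      ultimately show False
        using prefers_asym[OF proper_prefsD(1)[OF assms(1) b(1)]] by blast
    next
      case 2
      have "{m'. (m', w) \<in> Y} \<subseteq> set (wp w)"
        using subE proper_prefsD[OF assms(2) b(2)] by (auto simp: E_def)
      moreover have mY: "(m, w) \<in> Y"
        using 2 by (simp add: RW_def)
      ultimately obtain v where v: "(v, w) \<in> Y" "\<And>y. (y, w) \<in> Y \<Longrightarrow> y \<noteq> v \<Longrightarrow> prefers (wp w) v y"
        using most_preferred_exists[of "{m'. (m', w) \<in> Y}" "wp w"] by (metis mY empty_iff mem_Collect_eq)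
      have "(v, w) \<notin> RW Y"
        using v prefers_asym[OF proper_prefsD(1)[OF assms(2) b(2)]] unfolding RW_def by blast
      then have vM: "(v, w) \<in> M"
        using v MY by blast
      then have "prefers (wp w) m v"
        using bw uniq2 by (metis snd_conv image_eqI)
      moreover have "prefers (wp w) v m"
        using v(2)[of m] mY vM b(4) by blast
      ultimately show False
        using prefers_asym[OF proper_prefsD(1)[OF assms(2) b(2)]] by blast
    qed
  qed
  ultimately show ?thesis
    unfolding stable_matching_def by auto
qed

text \<open>The men who prefer \<open>M\<close> to \<open>M'\<close> are injected by \<open>M\<close> into the women who prefer \<open>M'\<close> to \<open>M\<close>,
  and the latter are injected by \<open>M'\<close> into the former. Hence both injections are onto, so that all
  men who prefer \<open>M\<close> are also matched in \<open>M'\<close>.\<close>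

lemma stable_matching_men_subset:
  assumes "proper_prefs n mp" "proper_prefs n wp"
    and "stable_matching n (mp, wp, adm) M" "stable_matching n (mp, wp, adm) M'"
  shows "fst ` M \<subseteq> fst ` M'"
proof
  have M: "matching n (mp, wp, adm) M" and M': "matching n (mp, wp, adm) M'"
    using assms by (auto simp: stable_matching_def)
  have sub: "M \<subseteq> {..<n} \<times> {..<n}" "M' \<subseteq> {..<n} \<times> {..<n}"
    using M M' by (auto simp: matching_def)
  have adm: "adm e" if "e \<in> M \<or> e \<in> M'" for e
    using M M' that by (auto simp: matching_def)
  have u1: "w = w'" if "(m, w) \<in> M" "(m, w') \<in> M" for m w w'
    using M that by (fastforce simp: matching_def)
  have u2: "m = m'" if "(m, w) \<in> M" "(m', w) \<in> M" for m m' w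
    using M that by (fastforce simp: matching_def)
  have u1': "w = w'" if "(m, w) \<in> M'" "(m, w') \<in> M'" for m w w'
    using M' that by (fastforce simp: matching_def)
  have u2': "m = m'" if "(m, w) \<in> M'" "(m', w) \<in> M'" for m m' w
    using M' that by (fastforce simp: matching_def)
  \<comment> \<open>The inner quantifier is vacuous for agents single in the other matching, so
    \<open>P\<close> contains every man matched only in \<open>M\<close>, and \<open>W\<close> every
    woman matched only in \<open>M'\<close>.\<close>
  define P where "P = {m. \<exists>w. (m, w) \<in> M \<and> (\<forall>w'. (m, w') \<in> M' \<longrightarrow> prefers (mp m) w w')}"
  define W where "W = {w. \<exists>m'. (m', w) \<in> M' \<and> (\<forall>m. (m, w) \<in> M \<longrightarrow> prefers (wp w) m' m)}"
  define g where "g m = (SOME w. (m, w) \<in> M)" for m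
  define h where "h w = (SOME m. (m, w) \<in> M')" for w
  have g: "(m, g m) \<in> M" if "m \<in> P" for m
    using that unfolding P_def g_def by (metis (mono_tags, lifting) mem_Collect_eq someI)
  have h: "(h w, w) \<in> M'" if "w \<in> W" for w
    using that unfolding W_def h_def by (metis (mono_tags, lifting) mem_Collect_eq someI)
  have finP: "finite P" and finW: "finite W"
    by (rule finite_subset[of _ "{..<n}"]; use sub in \<open>auto simp: P_def W_def\<close>)+
  have gW: "g m \<in> W" if m: "m \<in> P" for m
  proof -
    let ?w = "g m"
    have mw: "(m, ?w) \<in> M" by (rule g[OF m])
    have lt: "m < n" "?w < n" using mw sub by auto
    have pref: "\<And>w'. (m, w') \<in> M' \<Longrightarrow> prefers (mp m) ?w w'"
      using m u1[OF mw] unfolding P_def by blast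
    have notin: "(m, ?w) \<notin> M'"
      using pref prefers_asym[OF proper_prefsD(1)[OF assms(1) lt(1)]] by blast
    \<comment> \<open>The man would gain by switching to \<open>?w\<close>, so stability of
      \<open>M'\<close> forces her to have a partner there whom she likes better.\<close>
    have "\<not> blocks n (mp, wp, adm) M' (m, ?w)"
      using assms(4) by (auto simp: stable_matching_def)
    then have "?w \<in> snd ` M'" "\<And>m'. (m', ?w) \<in> M' \<Longrightarrow> \<not> prefers (wp ?w) m m'"
      using lt notin adm[of "(m, ?w)"] mw pref unfolding blocks_def by force+
    then obtain m' where m': "(m', ?w) \<in> M'" "\<not> prefers (wp ?w) m m'"
      by auto
    then have "prefers (wp ?w) m' m"
      using prefers_total[of m "wp ?w" m'] proper_prefsD(2)[OF assms(2) lt(2)] lt notin sub by blast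
    then show ?thesis
      unfolding W_def using m'(1) u2[OF mw] by blast
  qed
  have hP: "h w \<in> P" if w: "w \<in> W" for w
  proof -
    let ?m = "h w"
    have mw: "(?m, w) \<in> M'" by (rule h[OF w])
    have lt: "?m < n" "w < n" using mw sub by auto
    have pref: "\<And>m. (m, w) \<in> M \<Longrightarrow> prefers (wp w) ?m m"
      using w u2'[OF mw] unfolding W_def by blast
    have notin: "(?m, w) \<notin> M"
      using pref prefers_asym[OF proper_prefsD(1)[OF assms(2) lt(2)]] by blast
    have "\<not> blocks n (mp, wp, adm) M (?m, w)"
      using assms(3) by (auto simp: stable_matching_def)
    then have "?m \<in> fst ` M" "\<And>w'. (?m, w') \<in> M \<Longrightarrow> \<not> prefers (mp ?m) w w'"
      using lt notin adm[of "(?m, w)"] mw pref unfolding blocks_def by force+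
    then obtain w' where w': "(?m, w') \<in> M" "\<not> prefers (mp ?m) w w'"
      by auto
    then have "prefers (mp ?m) w' w"
      using prefers_total[of w "mp ?m" w'] proper_prefsD(2)[OF assms(1) lt(1)] lt notin sub by blast
    then show ?thesis
      unfolding P_def using w'(1) u1'[OF mw] by blast
  qed
  have injg: "inj_on g P"
    by (rule inj_onI) (metis g u2)
  have injh: "inj_on h W"
    by (rule inj_onI) (metis h u1')
  have "card P \<le> card W"
    using card_inj_on_le[OF injg _ finW] gW by blast
  then have "card (h ` W) = card P"
    using card_image[OF injh] card_inj_on_le[OF injh _ finP] hP by force
  then have hW: "h ` W = P"
    using hP finP by (intro card_subset_eq) auto
  fix m assume "m \<in> fst ` M"
  then obtain w where w: "(m, w) \<in> M" by auto
  show "m \<in> fst ` M'"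
  proof (rule ccontr)
    assume "m \<notin> fst ` M'"
    \<comment> \<open>Membership is vacuous for a man single in \<open>M'\<close>; but
      \<open>P\<close> is the image of \<open>h\<close>, and all values of \<open>h\<close> are
      matched in \<open>M'\<close>.\<close>
    then have "m \<in> P"
      using w unfolding P_def by force
    then show False
      using hW h \<open>m \<notin> fst ` M'\<close> by force
  qed
qed

lemma card_matching_fst:
  assumes "matching n I M"
  shows "card (fst ` M) = card M"
proof (rule card_image)
  show "inj_on fst M"
    using assms by (cases I) (auto simp: matching_def inj_on_def)
qed

text \<open>The inclusion of matched men, applied in both directions, shows that all stable
  matchings have one size, so the definite description in \<open>stable_size\<close> denotes
  it.\<close>

lemma stable_size_eqI:
  assumes "proper_prefs n mp" "proper_prefs n wp" "stable_matching n (mp, wp, adm) M"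
  shows "stable_size n (mp, wp, adm) = card M"
  unfolding stable_size_def
proof (rule the_equality)
  fix k assume "\<exists>M'. stable_matching n (mp, wp, adm) M' \<and> card M' = k"
  then obtain M' where M': "stable_matching n (mp, wp, adm) M'" "card M' = k" by blast
  have "fst ` M' = fst ` M"
    using stable_matching_men_subset assms M' by (meson subset_antisym)
  then show "k = card M"
    using card_matching_fst M' assms(3) by (metis stable_matching_def)
qed (use assms in blast)

lemma card_matching_le:
  assumes "matching n I M"
  shows "card M \<le> n"
proof -
  have "fst ` M \<subseteq> {..<n}"
    using assms by (cases I) (auto simp: matching_def)
  then show ?thesis
    using card_matching_fst[OF assms] card_mono[of "{..<n}" "fst ` M"] by simp
qed

subsection \<open>Uniform permutations and the Beta integral\<close>

definition unif :: "real measure" where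
  "unif = restrict_space lborel {0..1}"

lemma space_unif [simp]: "space unif = {0..1}"
  by (simp add: unif_def space_restrict_space)

lemma borel_measurable_unif: "f \<in> borel_measurable borel \<Longrightarrow> f \<in> borel_measurable unif"
  unfolding unif_def by (rule measurable_restrict_space1) simp

lemma nn_integral_unif: "(\<integral>\<^sup>+y. f y \<partial>unif) = (\<integral>\<^sup>+y. f y * indicator {0..1} y \<partial>lborel)"
  unfolding unif_def by (subst nn_integral_restrict_space) auto

lemma prob_space_unif: "prob_space unif"
  by (rule prob_spaceI) (simp add: unif_def emeasure_restrict_space)

lemma prefers_append_iff:
  assumes "distinct (xs @ w # ys)"
  shows "prefers (xs @ w # ys) j w \<longleftrightarrow> j \<in> set xs"
proof
  let ?l = "xs @ w # ys"
  assume "prefers ?l j w"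
  then obtain a b where ab: "a < b" "b < length ?l" "?l ! a = j" "?l ! b = w"
    unfolding prefers_def by blast
  have "?l ! length xs = w" by simp
  then have "b = length xs"
    using ab(2,4) assms by (metis add_gr_0 length_Cons length_append less_add_same_cancel1 nth_eq_iff_index_eq zero_less_Suc)
  then show "j \<in> set xs"
    using ab by (auto simp: nth_append)
next
  assume "j \<in> set xs"
  then obtain a where "a < length xs" "xs ! a = j"
    by (auto simp: in_set_conv_nth)
  then show "prefers (xs @ w # ys) j w"
    unfolding prefers_def by (intro exI[of _ a] exI[of _ "length xs"]) (auto simp: nth_append)
qed

text \<open>Such a list consists of an arrangement of \<open>S\<close>, then \<open>w\<close>, then
  an arrangement of the remaining elements, and this splitting is unique.\<close>

lemma card_permutations_before:
  assumes "finite A" "w \<in> A" "S \<subseteq> A - {w}"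
  shows "card {l \<in> permutations_of_set A. {j. prefers l j w} = S} = fact (card S) * fact (card A - 1 - card S)"
proof -
  let ?R = "A - {w} - S"
  let ?f = "\<lambda>(xs, ys). xs @ w # ys"
  have finS: "finite S" and finR: "finite ?R"
    using assms finite_subset by blast+
  have eq: "{l \<in> permutations_of_set A. {j. prefers l j w} = S} =
      ?f ` (permutations_of_set S \<times> permutations_of_set ?R)" (is "?L = ?I")
  proof (intro equalityI subsetI)
    fix l assume "l \<in> ?L"
    then have l: "distinct l" "set l = A" "{j. prefers l j w} = S"
      by (auto simp: permutations_of_set_def)
    then obtain xs ys where xy: "l = xs @ w # ys"
      using assms(2) by (metis split_list)
    have "S = set xs"
      using l(3) prefers_append_iff[of xs w ys] l(1) xy by auto
    moreover from this have "set ys = ?R"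
      using l xy by auto
    ultimately show "l \<in> ?I"
      using xy l(1) by (intro image_eqI[of _ _ "(xs, ys)"]) (auto simp: permutations_of_set_def)
  next
    fix l assume "l \<in> ?I"
    then obtain xs ys where xy: "l = xs @ w # ys" "set xs = S" "distinct xs" "set ys = ?R" "distinct ys"
      by (auto simp: permutations_of_set_def)
    then have d: "distinct l" "set l = A"
      using assms by auto
    then show "l \<in> ?L"
      using prefers_append_iff[of xs w ys] xy by (auto simp: permutations_of_set_def)
  qed
  have "inj_on ?f (permutations_of_set S \<times> permutations_of_set ?R)"
  proof (rule inj_onI, clarify)
    fix xs ys xs' ys'
    assume "xs \<in> permutations_of_set S" "xs' \<in> permutations_of_set S" and e: "xs @ w # ys = xs' @ w # ys'"
    then have "length xs = length xs'"
      by (metis length_finite_permutations_of_set)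
    then show "xs = xs' \<and> ys = ys'"
      using e by simp
  qed
  moreover have "card ?R = card A - 1 - card S"
    using assms finS by (simp add: card_Diff_subset)
  ultimately show ?thesis
    unfolding eq by (simp add: card_image card_cartesian_product finS finR)
qed

lemma has_integral_Beta_nat:
  "((\<lambda>y::real. y ^ a * (1 - y) ^ b) has_integral (fact a * fact b / fact (a + b + 1))) {0..1}"
proof -
  have "Beta (real a + 1) (real b + 1) = fact a * fact b / fact (a + b + 1)"
    using Gamma_fact[of a, where 'a=real] Gamma_fact[of b, where 'a=real]
      Gamma_fact[of "a + b + 1", where 'a=real]
    by (simp add: Beta_def add_ac)
  moreover have "((\<lambda>t::real. t powr (real a + 1 - 1) * (1 - t) powr (real b + 1 - 1))
      has_integral Beta (real a + 1) (real b + 1)) {0..1}"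
    by (rule has_integral_Beta_real) auto
  ultimately have *: "((\<lambda>t::real. t powr real a * (1 - t) powr real b)
      has_integral fact a * fact b / fact (a + b + 1)) {0..1}"
    by simp
  \<comment> \<open>Since \<open>0 powr 0 = 0\<close> but \<open>0 ^ 0 = 1\<close>, the two
    integrands may differ at the endpoints.\<close>
  show ?thesis
    by (rule has_integral_spike_finite[OF _ _ *, of "{0, 1}"]) (auto simp: powr_realpow)
qed

text \<open>Under a uniform permutation the set of elements before \<open>w\<close> is distributed like a random set
  that contains each other element with probability \<open>y\<close>, for \<open>y\<close> uniform on the unit interval:
  a set of size \<open>s\<close> has probability \<open>s! (N - s)! / (N + 1)!\<close>, a Beta integral.\<close>

lemma nn_integral_permutation_before:
  fixes A :: "nat set" and \<alpha> :: "nat \<Rightarrow> real"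
  assumes "finite A" "w \<in> A" and \<alpha>: "\<And>i. i \<in> A - {w} \<Longrightarrow> 0 \<le> \<alpha> i \<and> \<alpha> i \<le> 1"
  shows "(\<integral>\<^sup>+l. (\<Prod>i\<in>A - {w}. ennreal (if prefers l i w then \<alpha> i else 1)) \<partial>pmf_of_set (permutations_of_set A))
    = (\<integral>\<^sup>+y. (\<Prod>i\<in>A - {w}. ennreal (1 - y * (1 - \<alpha> i))) \<partial>unif)"
proof -
  let ?U = "A - {w}"
  let ?N = "card A - 1"
  let ?P = "permutations_of_set A"
  let ?c = "\<lambda>S. fact (card S) * fact (?N - card S) :: real"
  have finU: "finite ?U" and cardU: "card ?U = ?N" and cA: "card A = ?N + 1"
    using assms(1,2) card_Suc_Diff1[OF assms(1,2)] by auto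
  have before: "(\<Prod>i\<in>?U. if prefers l i w then \<alpha> i else 1) = (\<Prod>i\<in>{j. prefers l j w}. \<alpha> i)"
    and sub: "{j. prefers l j w} \<in> Pow ?U" if "l \<in> ?P" for l
  proof -
    have l: "distinct l" "set l = A"
      using that by (auto simp: permutations_of_set_def)
    then obtain xs ys where xy: "l = xs @ w # ys"
      using assms(2) by (metis split_list)
    then have "{j. prefers l j w} = set xs" "set xs \<subseteq> ?U"
      using l prefers_append_iff[of xs w ys] by auto
    then show "{j. prefers l j w} \<in> Pow ?U"
      by simp
    then show "(\<Prod>i\<in>?U. if prefers l i w then \<alpha> i else 1) = (\<Prod>i\<in>{j. prefers l j w}. \<alpha> i)"
      using finU by (subst prod.inter_filter[symmetric]) (auto intro!: prod.cong)
  qed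
  have nonneg: "0 \<le> (if prefers l i w then \<alpha> i else 1)" if "i \<in> ?U" for i l
    using \<alpha>[OF that] by simp
  have prod_enn: "(\<Prod>i\<in>?U. ennreal (if prefers l i w then \<alpha> i else 1)) =
      ennreal (\<Prod>i\<in>?U. if prefers l i w then \<alpha> i else 1)" for l
    by (intro prod_ennreal nonneg)
  have "(\<Sum>l\<in>?P. \<Prod>i\<in>?U. if prefers l i w then \<alpha> i else 1) = (\<Sum>l\<in>?P. \<Prod>i\<in>{j. prefers l j w}. \<alpha> i)"
    by (intro sum.cong before refl)
  \<comment> \<open>The product depends on the list only through the set \<open>S\<close> of
    elements before \<open>w\<close>, so lists are grouped by \<open>S\<close>.\<close>
  also have "\<dots> = (\<Sum>S\<in>Pow ?U. \<Sum>l\<in>{l \<in> ?P. {j. prefers l j w} = S}. \<Prod>i\<in>{j. prefers l j w}. \<alpha> i)"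
    using finU sub by (intro sum.group[symmetric]) auto
  also have "\<dots> = (\<Sum>S\<in>Pow ?U. \<Sum>l\<in>{l \<in> ?P. {j. prefers l j w} = S}. \<Prod>i\<in>S. \<alpha> i)"
    by (intro sum.cong refl) auto
  also have "\<dots> = (\<Sum>S\<in>Pow ?U. ?c S * (\<Prod>i\<in>S. \<alpha> i))"
    using card_permutations_before[OF assms(1,2)] by (intro sum.cong refl) simp
  finally have sum_eq: "(\<Sum>l\<in>?P. \<Prod>i\<in>?U. if prefers l i w then \<alpha> i else 1) = (\<Sum>S\<in>Pow ?U. ?c S * (\<Prod>i\<in>S. \<alpha> i))" .
  \<comment> \<open>Each factor is \<open>y * \<alpha> i + (1 - y)\<close>: the element
    \<open>i\<close> joins \<open>S\<close> with probability \<open>y\<close> and then contributes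
    \<open>\<alpha> i\<close>.\<close>
  have expand: "(\<Prod>i\<in>?U. 1 - y * (1 - \<alpha> i)) = (\<Sum>S\<in>Pow ?U. y ^ card S * (1 - y) ^ (?N - card S) * (\<Prod>i\<in>S. \<alpha> i))" for y
  proof -
    have "(\<Prod>i\<in>?U. 1 - y * (1 - \<alpha> i)) = (\<Prod>i\<in>?U. y * \<alpha> i + (1 - y))"
      by (simp add: algebra_simps)
    also have "\<dots> = (\<Sum>S\<in>Pow ?U. (\<Prod>i\<in>S. y * \<alpha> i) * (\<Prod>i\<in>?U - S. 1 - y))"
      by (rule prod_add[OF finU])
    also have "\<dots> = (\<Sum>S\<in>Pow ?U. y ^ card S * (1 - y) ^ (?N - card S) * (\<Prod>i\<in>S. \<alpha> i))"
    proof (intro sum.cong refl)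
      fix S assume "S \<in> Pow ?U"
      then have "card (?U - S) = ?N - card S"
        using finU by (metis Pow_iff card_Diff_subset cardU finite_subset)
      then show "(\<Prod>i\<in>S. y * \<alpha> i) * (\<Prod>i\<in>?U - S. 1 - y) = y ^ card S * (1 - y) ^ (?N - card S) * (\<Prod>i\<in>S. \<alpha> i)"
        by (simp only: prod.distrib prod_constant mult_ac)
    qed
    finally show ?thesis .
  qed
  have "((\<lambda>y. \<Sum>S\<in>Pow ?U. y ^ card S * (1 - y) ^ (?N - card S) * (\<Prod>i\<in>S. \<alpha> i)) has_integral
      (\<Sum>S\<in>Pow ?U. fact (card S) * fact (?N - card S) / fact (card S + (?N - card S) + 1) * (\<Prod>i\<in>S. \<alpha> i))) {0..1}"
    using finU by (intro has_integral_sum has_integral_mult_left has_integral_Beta_nat) auto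
  also have "(\<Sum>S\<in>Pow ?U. fact (card S) * fact (?N - card S) / fact (card S + (?N - card S) + 1) * (\<Prod>i\<in>S. \<alpha> i))
      = (\<Sum>S\<in>Pow ?U. ?c S * (\<Prod>i\<in>S. \<alpha> i)) / fact (card A)"
    unfolding sum_divide_distrib
  proof (intro sum.cong refl)
    fix S assume "S \<in> Pow ?U"
    then have "card S \<le> ?N"
      using finU cardU by (metis Pow_iff card_mono)
    then have "card S + (?N - card S) + 1 = card A"
      using cA by simp
    then show "fact (card S) * fact (?N - card S) / fact (card S + (?N - card S) + 1) * (\<Prod>i\<in>S. \<alpha> i)
      = ?c S * (\<Prod>i\<in>S. \<alpha> i) / fact (card A)"
      by simp
  qed
  finally have int: "((\<lambda>y. \<Prod>i\<in>?U. 1 - y * (1 - \<alpha> i)) has_integral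
      (\<Sum>S\<in>Pow ?U. ?c S * (\<Prod>i\<in>S. \<alpha> i)) / fact (card A)) {0..1}"
    by (simp only: expand)
  have fac_nonneg: "0 \<le> 1 - y * (1 - \<alpha> i)" if "y \<in> {0..1}" "i \<in> ?U" for y i
    using that \<alpha>[OF that(2)] mult_le_one[of y "1 - \<alpha> i"] by auto
  have "(\<integral>\<^sup>+y. (\<Prod>i\<in>?U. ennreal (1 - y * (1 - \<alpha> i))) \<partial>unif)
      = (\<integral>\<^sup>+y. ennreal (\<Prod>i\<in>?U. 1 - y * (1 - \<alpha> i)) * indicator {0..1} y \<partial>lborel)"
    unfolding nn_integral_unif
  proof (intro nn_integral_cong)
    fix y :: real
    show "(\<Prod>i\<in>?U. ennreal (1 - y * (1 - \<alpha> i))) * indicator {0..1} y =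
        ennreal (\<Prod>i\<in>?U. 1 - y * (1 - \<alpha> i)) * indicator {0..1} y"
      using prod_ennreal[of ?U "\<lambda>i. 1 - y * (1 - \<alpha> i)"] fac_nonneg[of y] by (cases "y \<in> {0..1}") auto
  qed
  also have "\<dots> = ennreal ((\<Sum>S\<in>Pow ?U. ?c S * (\<Prod>i\<in>S. \<alpha> i)) / fact (card A))"
    by (rule nn_integral_has_integral_lebesgue'[OF _ int]) (rule prod_nonneg, rule fac_nonneg)
  finally have rhs: "(\<integral>\<^sup>+y. (\<Prod>i\<in>?U. ennreal (1 - y * (1 - \<alpha> i))) \<partial>unif)
    = ennreal ((\<Sum>S\<in>Pow ?U. ?c S * (\<Prod>i\<in>S. \<alpha> i)) / fact (card A))" .
  have ne: "?P \<noteq> {}" "finite ?P" and cP: "card ?P = fact (card A)"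
    using assms(1) by auto
  have "(\<integral>\<^sup>+l. (\<Prod>i\<in>?U. ennreal (if prefers l i w then \<alpha> i else 1)) \<partial>pmf_of_set ?P)
      = (\<Sum>l\<in>?P. ennreal (\<Prod>i\<in>?U. if prefers l i w then \<alpha> i else 1)) / ennreal (fact (card A))"
    unfolding nn_integral_pmf_of_set[OF ne] prod_enn
    by (simp only: cP ennreal_of_nat_eq_real_of_nat of_nat_fact)
  also have "(\<Sum>l\<in>?P. ennreal (\<Prod>i\<in>?U. if prefers l i w then \<alpha> i else 1)) =
      ennreal (\<Sum>l\<in>?P. \<Prod>i\<in>?U. if prefers l i w then \<alpha> i else 1)"
    by (intro sum_ennreal prod_nonneg nonneg)
  also have "\<dots> / ennreal (fact (card A)) = ennreal ((\<Sum>S\<in>Pow ?U. ?c S * (\<Prod>i\<in>S. \<alpha> i)) / fact (card A))"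
    unfolding sum_eq using \<alpha>
    by (intro divide_ennreal sum_nonneg mult_nonneg_nonneg prod_nonneg) auto
  finally show ?thesis
    using rhs by simp
qed

subsection \<open>The probability that a fixed matching is stable\<close>

abbreviation uniform_list :: "nat \<Rightarrow> nat list pmf" where
  "uniform_list n \<equiv> pmf_of_set (permutations_of_set {..<n})"

text \<open>The averaging formula with the partner \<open>w\<close> included as a factor 1. Products
  then run over all of \<open>{..<n}\<close>, so that products over men and women can be
  interchanged.\<close>

lemma nn_integral_uniform_list_before:
  assumes "w < n" and "\<And>i. i < n \<Longrightarrow> 0 \<le> \<beta> i \<and> \<beta> i \<le> 1"
  shows "(\<integral>\<^sup>+l. (\<Prod>i<n. ennreal (if i \<noteq> w \<and> prefers l i w then \<beta> i else 1)) \<partial>uniform_list n)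
    = (\<integral>\<^sup>+y. (\<Prod>i<n. ennreal (if i \<noteq> w then 1 - y * (1 - \<beta> i) else 1)) \<partial>unif)"
proof -
  have *: "(\<Prod>i<n. ennreal (if i \<noteq> w \<and> P i then a i else 1)) =
      (\<Prod>i\<in>{..<n} - {w}. ennreal (if P i then a i else 1))" for P and a :: "nat \<Rightarrow> real"
    using assms(1) by (subst prod.remove[of _ w]) (auto intro!: prod.cong)
  show ?thesis
    using nn_integral_permutation_before[of "{..<n}" w \<beta>] assms *[of "\<lambda>_. True" "\<lambda>i. 1 - _ * (1 - \<beta> i)"]
    by (simp add: * lessThan_iff)
qed

lemma prod_ennreal_le_1: "(\<And>i. i \<in> I \<Longrightarrow> f i \<le> 1) \<Longrightarrow> prod f I \<le> (1 :: ennreal)"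
  using prod_mono_ennreal[of I f "\<lambda>_. 1"] by simp

text \<open>The integral over \<open>P\<close> is a finite sum, so additivity suffices for the
  exchange.\<close>

lemma nn_integral_swap_finite_pmf:
  assumes "finite (set_pmf P)" and [measurable]: "\<And>x. x \<in> set_pmf P \<Longrightarrow> F x \<in> borel_measurable N"
  shows "(\<integral>\<^sup>+x. (\<integral>\<^sup>+y. F x y \<partial>N) \<partial>measure_pmf P) = (\<integral>\<^sup>+y. (\<integral>\<^sup>+x. F x y \<partial>measure_pmf P) \<partial>N)"
proof -
  have "(\<integral>\<^sup>+x. (\<integral>\<^sup>+y. F x y \<partial>N) \<partial>measure_pmf P) = (\<Sum>x\<in>set_pmf P. \<integral>\<^sup>+y. F x y * pmf P x \<partial>N)"
    using assms by (simp add: nn_integral_measure_pmf_finite nn_integral_multc)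
  also have "\<dots> = (\<integral>\<^sup>+y. (\<Sum>x\<in>set_pmf P. F x y * pmf P x) \<partial>N)"
    by (rule nn_integral_sum[symmetric]) (use assms in auto)
  also have "\<dots> = (\<integral>\<^sup>+y. (\<integral>\<^sup>+x. F x y \<partial>measure_pmf P) \<partial>N)"
    using assms by (simp add: nn_integral_measure_pmf_finite)
  finally show ?thesis .
qed

text \<open>The exact value is \<open>(1 - exp (- c)) / c\<close>.\<close>

lemma nn_integral_exp_unif_le:
  assumes "0 < c"
  shows "(\<integral>\<^sup>+x. ennreal (exp (- (x * c))) \<partial>unif) \<le> ennreal (1 / c)"
proof -
  have "(\<integral>\<^sup>+x. ennreal (exp (- (x * c))) \<partial>unif) = ennreal (- exp (- (1 * c)) / c - (- exp (- (0 * c)) / c))"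
    unfolding nn_integral_unif
  proof (rule nn_integral_FTC_Icc)
    show "((\<lambda>x. - exp (- (x * c)) / c) has_real_derivative exp (- (x * c))) (at x)" for x
      using assms by (auto intro!: derivative_eq_intros)
  qed auto
  also have "\<dots> \<le> ennreal (1 / c)"
    using assms by (intro ennreal_leI) (simp add: field_simps)
  finally show ?thesis .
qed

lemma prod_one_minus_le_exp:
  fixes a :: "'a \<Rightarrow> real"
  assumes "\<And>i. i \<in> I \<Longrightarrow> a i \<le> 1"
  shows "(\<Prod>i\<in>I. 1 - a i) \<le> exp (- (\<Sum>i\<in>I. a i))"
proof (cases "finite I")
  case True
  have "(\<Prod>i\<in>I. 1 - a i) \<le> (\<Prod>i\<in>I. exp (- a i))"
    using assms exp_ge_add_one_self[of "- a _"] by (intro prod_mono) auto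
  then show ?thesis
    using True by (simp add: exp_sum flip: sum_negf)
qed simp

text \<open>Each factor is \<open>1 + y j / (c - y j) \<le> 1 + 2 y j / c\<close>, and \<open>y\<close> sums to at most \<open>c\<close>.\<close>

lemma prod_inverse_sub_le:
  fixes y :: "'a \<Rightarrow> real"
  assumes "finite I" "1 \<le> K" and y: "\<And>j. j \<in> I \<Longrightarrow> 0 \<le> y j \<and> y j \<le> 1"
  defines "c \<equiv> K + (\<Sum>j\<in>I. y j)"
  shows "(\<Prod>j\<in>I. 1 / (c - y j)) \<le> exp 2 / c ^ card I"
proof -
  have sum_nonneg: "0 \<le> (\<Sum>j\<in>I. y j)"
    using y by (auto intro: sum_nonneg)
  then have c: "1 \<le> c"
    using assms by simp
  have "1 / (c - y j) \<le> (1 / c) * exp (2 * y j / c)" and pos: "0 \<le> 1 / (c - y j)" if j: "j \<in> I" for j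
  proof -
    have "y j \<le> (\<Sum>j\<in>I. y j)"
      using j y assms(1) by (intro member_le_sum) auto
    moreover have "y j \<le> K"
      using y[OF j] assms(2) by linarith
    ultimately have le: "1 \<le> c - y j" "2 * y j \<le> c"
      using assms(2) unfolding c_def by linarith+
    then show "0 \<le> 1 / (c - y j)" by simp
    have "y j * (2 * y j) \<le> y j * c"
      using le y[OF j] by (intro mult_left_mono) auto
    \<comment> \<open>The right side equals \<open>c + y j - 2 * (y j)^2 / c\<close>.\<close>
    then have "c \<le> (1 + 2 * y j / c) * (c - y j)"
      using c by (simp add: field_simps)
    then have "1 / (c - y j) \<le> (1 / c) * (1 + 2 * y j / c)"
      using c le by (simp add: field_simps)
    also have "\<dots> \<le> (1 / c) * exp (2 * y j / c)"
      using c by (intro mult_left_mono exp_ge_add_one_self) auto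
    finally show "1 / (c - y j) \<le> (1 / c) * exp (2 * y j / c)" .
  qed
  then have "(\<Prod>j\<in>I. 1 / (c - y j)) \<le> (\<Prod>j\<in>I. (1 / c) * exp (2 * y j / c))"
    by (intro prod_mono) auto
  also have "\<dots> = (1 / c) ^ card I * exp (2 * (\<Sum>j\<in>I. y j) / c)"
    unfolding prod.distrib using assms(1)
    by (simp add: exp_sum[symmetric] sum_distrib_left sum_divide_distrib del: times_divide_eq_left)
  also have "\<dots> \<le> (1 / c) ^ card I * exp 2"
  proof -
    have "2 * (\<Sum>j\<in>I. y j) / c \<le> 2"
      using c assms(2) sum_nonneg by (simp add: field_simps c_def)
    then show ?thesis
      using c by (intro mult_left_mono) auto
  qed
  finally show ?thesis
    by (simp add: power_one_over)
qed

text \<open>The integrand is \<open>1 / l ^ Suc r\<close> times the Erlang density of rate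
  \<open>l\<close>, which integrates to 1. Read from right to left, it turns a negative power into
  an integral of exponentials.\<close>

lemma nn_integral_gamma_kernel:
  assumes "0 < l"
  shows "(\<integral>\<^sup>+u. ennreal (u ^ r * exp (- (l * u)) / fact r) * indicator {0..} u \<partial>lborel) = ennreal (1 / l ^ Suc r)"
proof -
  have "(\<integral>\<^sup>+u. ennreal (u ^ r * exp (- (l * u)) / fact r) * indicator {0..} u \<partial>lborel) =
      (\<integral>\<^sup>+u. ennreal (1 / l ^ Suc r) * ennreal (erlang_density r l u * u ^ 0) \<partial>lborel)"
    using assms by (intro nn_integral_cong)
      (auto simp: erlang_density_def ennreal_mult[symmetric] field_simps split: split_indicator)
  also have "\<dots> = ennreal (1 / l ^ Suc r) * 1"
    using nn_integral_erlang_ith_moment[OF assms, of r 0] by (subst nn_integral_cmult) auto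
  finally show ?thesis by simp
qed

section \<open>One fixed matching, given by its matched men and their partners\<close>

locale partial_matching =
  fixes n :: nat and p :: real and A :: "nat set" and f :: "nat \<Rightarrow> nat"
  assumes p: "0 < p" "p < 1"
    and A: "A \<subseteq> {..<n}" and fA: "f ` A \<subseteq> {..<n}" and inj: "inj_on f A"
begin

text \<open>\<open>B\<close> consists of the matched women, \<open>g\<close> returns the partner of
  such a woman, and \<open>k\<close> is the number of singles on either side.\<close>

definition "B = f ` A"
definition "g = inv_into A f"
definition "M = (\<lambda>i. (i, f i)) ` A"
definition "k = n - card A"
text \<open>A single woman accepts every man; this is the case of the coordinate 1, acceptance with
  certainty.\<close>

definition "Y y j = (if j \<in> B then y j else 1 :: real)"

abbreviation "cube \<equiv> Pi\<^sub>M B (\<lambda>_. unif)"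

lemma finA: "finite A" and finB: "finite B" and cardB: "card B = card A" and B: "B \<subseteq> {..<n}"
  using A fA finite_subset[OF A] finite_subset[OF fA] inj card_mono[OF _ A]
  by (auto simp: B_def card_image k_def)

lemma g: "j \<in> B \<Longrightarrow> g j \<in> A" "j \<in> B \<Longrightarrow> f (g j) = j" "i \<in> A \<Longrightarrow> g (f i) = i"
  unfolding B_def g_def using inj by (auto intro: inv_into_into f_inv_into_f)

lemma M_iff: "(i, j) \<in> M \<longleftrightarrow> i \<in> A \<and> j = f i"
  by (auto simp: M_def)

lemma M_iff': "(i, j) \<in> M \<longleftrightarrow> j \<in> B \<and> i = g j"
  using g by (auto simp: M_iff B_def)

lemma fst_M: "fst ` M = A" and snd_M: "snd ` M = B"
  by (auto simp: M_def B_def image_image)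

text \<open>Willingness to leave for the other agent; singles are always willing. A pair outside
  \<open>M\<close> blocks exactly when it is admissible and both sides are willing.\<close>

definition "prefM mp i j \<longleftrightarrow> (i \<in> A \<longrightarrow> prefers (mp i) j (f i))" for mp :: "nat \<Rightarrow> nat list" and i j
definition "prefW wp i j \<longleftrightarrow> (j \<in> B \<longrightarrow> prefers (wp j) i (g j))" for wp :: "nat \<Rightarrow> nat list" and i j

lemma stable_matchingD:
  assumes "stable_matching n (mp, wp, adm) M" "i < n" "j < n"
  shows "(i, j) \<in> M \<Longrightarrow> adm (i, j)"
    and "(i, j) \<notin> M \<Longrightarrow> prefM mp i j \<Longrightarrow> prefW wp i j \<Longrightarrow> \<not> adm (i, j)"
proof -
  show "(i, j) \<in> M \<Longrightarrow> adm (i, j)"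
    using assms(1) by (auto simp: stable_matching_def matching_def)
  assume *: "(i, j) \<notin> M" "prefM mp i j" "prefW wp i j"
  have "i \<notin> fst ` M \<or> (\<exists>w'. (i, w') \<in> M \<and> prefers (mp i) j w')"
    using *(2) unfolding prefM_def fst_M by (auto simp: M_iff)
  moreover have "j \<notin> snd ` M \<or> (\<exists>m'. (m', j) \<in> M \<and> prefers (wp j) i m')"
    using *(3) unfolding prefW_def snd_M by (auto simp: M_iff')
  ultimately show "\<not> adm (i, j)"
    using assms * by (auto simp: stable_matching_def blocks_def)
qed

text \<open>For given lists, stability makes every pair of \<open>M\<close> admissible and every
  other mutually willing pair inadmissible. These requirements concern distinct pairs, so their
  probabilities multiply.\<close>

lemma emeasure_admissible_stable:
  "emeasure (Pi_pmf ({..<n} \<times> {..<n}) False (\<lambda>_. bernoulli_pmf p)) {adm. stable_matching n (mp, wp, adm) M}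
   \<le> ennreal (p ^ card A) *
      (\<Prod>j<n. \<Prod>i<n. ennreal (if (i, j) \<notin> M \<and> prefM mp i j \<and> prefW wp i j then 1 - p else 1))"
proof -
  let ?S = "{..<n} \<times> {..<n}"
  let ?h = "\<lambda>(i, j). if (i, j) \<notin> M \<and> prefM mp i j \<and> prefW wp i j then 1 - p else 1"
  define T where "T = (\<lambda>(i, j). if (i, j) \<in> M then {True} else if prefM mp i j \<and> prefW wp i j then {False} else UNIV)"
  have M: "M \<subseteq> ?S" "card M = card A"
    using A fA by (auto simp: M_def card_image inj_on_def)
  have "{adm. stable_matching n (mp, wp, adm) M} \<subseteq> Pi ?S T"
    by (auto simp: T_def dest: stable_matchingD)
  then have "emeasure (Pi_pmf ?S False (\<lambda>_. bernoulli_pmf p)) {adm. stable_matching n (mp, wp, adm) M}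
      \<le> emeasure (Pi_pmf ?S False (\<lambda>_. bernoulli_pmf p)) (Pi ?S T)"
    by (intro emeasure_mono) auto
  also have "\<dots> = ennreal (\<Prod>e\<in>?S. measure_pmf.prob (bernoulli_pmf p) (T e))"
    by (simp add: measure_pmf.emeasure_eq_measure measure_Pi_pmf_Pi)
  also have "(\<Prod>e\<in>?S. measure_pmf.prob (bernoulli_pmf p) (T e)) = (\<Prod>e\<in>?S. (if e \<in> M then p else 1) * ?h e)"
    using p by (intro prod.cong refl) (auto simp: T_def measure_pmf_single)
  also have "\<dots> = p ^ card A * (\<Prod>e\<in>?S. ?h e)"
    unfolding prod.distrib using M by (simp add: prod.If_cases Int_absorb1)
  also have "(\<Prod>e\<in>?S. ?h e) = (\<Prod>i<n. \<Prod>j<n. ?h (i, j))"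
    by (simp add: prod.cartesian_product)
  also have "\<dots> = (\<Prod>j<n. \<Prod>i<n. ?h (i, j))"
    by (rule prod.swap)
  finally show ?thesis
    using p by (simp add: ennreal_mult prod_nonneg prod_ennreal)
qed

lemma Y_bounds: "y \<in> space cube \<Longrightarrow> 0 \<le> Y y j \<and> Y y j \<le> 1"
  by (auto simp: Y_def space_PiM PiE_def Pi_def)

lemma Y_measurable [measurable]: "(\<lambda>y. Y y j) \<in> borel_measurable cube"
proof (cases "j \<in> B")
  case True
  have "(\<lambda>v::real. v) \<in> borel_measurable unif"
    by (rule borel_measurable_unif) simp
  then have "(\<lambda>y. y j) \<in> borel_measurable cube"
    by (rule measurable_compose[OF measurable_component_singleton[OF True]])
  then show ?thesis
    using True by (simp add: Y_def)
qed (simp add: Y_def)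

interpretation cube: product_prob_space "\<lambda>_::nat. unif" B
  by (intro product_prob_spaceI prob_space_unif)

lemma emeasure_cube: "emeasure cube (space cube) = 1"
  using cube.P.emeasure_space_1 by simp

text \<open>With the men's lists fixed, the product splits into independent factors, one per woman.
  For a matched woman the random list is traded for a uniform coordinate \<open>y j\<close>; for a
  single woman the factor does not depend on her list.\<close>

lemma nn_integral_women:
  "(\<integral>\<^sup>+wp. (\<Prod>j<n. \<Prod>i<n. ennreal (if (i, j) \<notin> M \<and> prefM mp i j \<and> prefW wp i j then 1 - p else 1))
      \<partial>Pi_pmf {..<n} [] (\<lambda>_. uniform_list n))
   = (\<integral>\<^sup>+y. (\<Prod>i<n. \<Prod>j<n. ennreal (if (i, j) \<notin> M \<and> prefM mp i j then 1 - p * Y y j else 1)) \<partial>cube)"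
proof -
  define h where "h j l = (\<Prod>i<n. ennreal (if (i, j) \<notin> M \<and> prefM mp i j \<and> (j \<in> B \<longrightarrow> prefers l i (g j)) then 1 - p else 1))" for j l
  define G where "G j v = (\<Prod>i<n. ennreal (if (i, j) \<notin> M \<and> prefM mp i j then 1 - p * v else 1))" for j and v :: real
  have hB: "(\<integral>\<^sup>+l. h j l \<partial>uniform_list n) = (\<integral>\<^sup>+v. G j v \<partial>unif)" if j: "j \<in> B" for j
  proof -
    let ?\<beta> = "\<lambda>i. if prefM mp i j then 1 - p else 1"
    have "(\<integral>\<^sup>+l. h j l \<partial>uniform_list n) =
        (\<integral>\<^sup>+l. (\<Prod>i<n. ennreal (if i \<noteq> g j \<and> prefers l i (g j) then ?\<beta> i else 1)) \<partial>uniform_list n)"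
      unfolding h_def using j by (intro nn_integral_cong prod.cong refl) (auto simp: M_iff')
    also have "\<dots> = (\<integral>\<^sup>+v. (\<Prod>i<n. ennreal (if i \<noteq> g j then 1 - v * (1 - ?\<beta> i) else 1)) \<partial>unif)"
      using g(1)[OF j] A p by (intro nn_integral_uniform_list_before) auto
    also have "\<dots> = (\<integral>\<^sup>+v. G j v \<partial>unif)"
      unfolding G_def using j by (intro nn_integral_cong prod.cong refl) (auto simp: M_iff' mult.commute)
    finally show ?thesis .
  qed
  have h0: "(\<integral>\<^sup>+l. h j l \<partial>uniform_list n) = G j 1" if "j \<notin> B" for j
    unfolding h_def G_def using that by (simp cong: if_cong)
  have G_meas: "G j \<in> borel_measurable unif" for j
    unfolding G_def by (rule borel_measurable_unif) measurable
  have comp_meas: "(\<lambda>y. G j (y j)) \<in> borel_measurable cube" if "j \<in> B" for j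
    by (rule measurable_compose[OF measurable_component_singleton[OF that] G_meas])
  have split: "{..<n} = B \<union> ({..<n} - B)"
    using B by blast
  have "(\<integral>\<^sup>+wp. (\<Prod>j<n. \<Prod>i<n. ennreal (if (i, j) \<notin> M \<and> prefM mp i j \<and> prefW wp i j then 1 - p else 1))
      \<partial>Pi_pmf {..<n} [] (\<lambda>_. uniform_list n)) = (\<integral>\<^sup>+wp. (\<Prod>j<n. h j (wp j)) \<partial>Pi_pmf {..<n} [] (\<lambda>_. uniform_list n))"
    by (simp add: h_def prefW_def)
  also have "\<dots> = (\<Prod>j<n. \<integral>\<^sup>+l. h j l \<partial>uniform_list n)"
    by (rule nn_integral_prod_Pi_pmf) simp
  also have "\<dots> = (\<Prod>j\<in>B. \<integral>\<^sup>+l. h j l \<partial>uniform_list n) * (\<Prod>j\<in>{..<n} - B. \<integral>\<^sup>+l. h j l \<partial>uniform_list n)"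
    using finB by (subst split, subst prod.union_disjoint) auto
  also have "\<dots> = (\<Prod>j\<in>B. \<integral>\<^sup>+v. G j v \<partial>unif) * (\<Prod>j\<in>{..<n} - B. G j 1)"
    by (intro arg_cong2[where f=times] prod.cong refl) (auto simp: hB h0)
  also have "(\<Prod>j\<in>B. \<integral>\<^sup>+v. G j v \<partial>unif) = (\<integral>\<^sup>+y. (\<Prod>j\<in>B. G j (y j)) \<partial>cube)"
    by (rule cube.product_nn_integral_prod[symmetric]) (use finB G_meas in auto)
  also have "\<dots> * (\<Prod>j\<in>{..<n} - B. G j 1) = (\<integral>\<^sup>+y. (\<Prod>j\<in>B. G j (y j)) * (\<Prod>j\<in>{..<n} - B. G j 1) \<partial>cube)"
    by (intro nn_integral_multc[symmetric] borel_measurable_prod_ennreal comp_meas)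
  also have "\<dots> = (\<integral>\<^sup>+y. (\<Prod>j<n. G j (Y y j)) \<partial>cube)"
  proof (intro nn_integral_cong)
    fix y
    have "(\<Prod>j<n. G j (Y y j)) = (\<Prod>j\<in>B. G j (Y y j)) * (\<Prod>j\<in>{..<n} - B. G j (Y y j))"
      using finB by (subst split, subst prod.union_disjoint) auto
    then show "(\<Prod>j\<in>B. G j (y j)) * (\<Prod>j\<in>{..<n} - B. G j 1) = (\<Prod>j<n. G j (Y y j))"
      by (simp add: Y_def)
  qed
  also have "\<dots> = (\<integral>\<^sup>+y. (\<Prod>i<n. \<Prod>j<n. ennreal (if (i, j) \<notin> M \<and> prefM mp i j then 1 - p * Y y j else 1)) \<partial>cube)"
    unfolding G_def by (subst prod.swap) (rule refl)
  finally show ?thesis .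
qed

text \<open>The same averaging over the men's lists, with \<open>y\<close> held fixed. Each of the
  \<open>k\<close> single men contributes the full product, which is the case
  \<open>x = 1\<close>.\<close>

lemma nn_integral_men:
  assumes y: "y \<in> space cube"
  shows "(\<integral>\<^sup>+mp. (\<Prod>i<n. \<Prod>j<n. ennreal (if (i, j) \<notin> M \<and> prefM mp i j then 1 - p * Y y j else 1))
      \<partial>Pi_pmf {..<n} [] (\<lambda>_. uniform_list n))
   = (\<Prod>i\<in>A. \<integral>\<^sup>+x. (\<Prod>j<n. ennreal (if j \<noteq> f i then 1 - x * (p * Y y j) else 1)) \<partial>unif) *
      (\<Prod>j<n. ennreal (1 - p * Y y j)) ^ k"
proof -
  define h where "h i l = (\<Prod>j<n. ennreal (if (i, j) \<notin> M \<and> (i \<in> A \<longrightarrow> prefers l j (f i)) then 1 - p * Y y j else 1))" for i l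
  have Yb: "0 \<le> p * Y y j \<and> p * Y y j \<le> 1" for j
    using Y_bounds[OF y, of j] p mult_le_one[of p "Y y j"] by auto
  have hA: "(\<integral>\<^sup>+l. h i l \<partial>uniform_list n) =
      (\<integral>\<^sup>+x. (\<Prod>j<n. ennreal (if j \<noteq> f i then 1 - x * (p * Y y j) else 1)) \<partial>unif)" if i: "i \<in> A" for i
  proof -
    have "(\<integral>\<^sup>+l. h i l \<partial>uniform_list n) =
        (\<integral>\<^sup>+l. (\<Prod>j<n. ennreal (if j \<noteq> f i \<and> prefers l j (f i) then 1 - p * Y y j else 1)) \<partial>uniform_list n)"
      unfolding h_def using i by (intro nn_integral_cong prod.cong refl) (auto simp: M_iff)
    also have "\<dots> = (\<integral>\<^sup>+x. (\<Prod>j<n. ennreal (if j \<noteq> f i then 1 - x * (1 - (1 - p * Y y j)) else 1)) \<partial>unif)"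
      using i fA Yb by (intro nn_integral_uniform_list_before) auto
    finally show ?thesis by (simp cong: if_cong)
  qed
  have h0: "(\<integral>\<^sup>+l. h i l \<partial>uniform_list n) = (\<Prod>j<n. ennreal (1 - p * Y y j))" if "i \<notin> A" for i
    using that by (simp add: h_def M_iff)
  have split: "{..<n} = A \<union> ({..<n} - A)" and card_rest: "card ({..<n} - A) = k"
    using A finA by (auto simp: card_Diff_subset k_def)
  have "(\<integral>\<^sup>+mp. (\<Prod>i<n. \<Prod>j<n. ennreal (if (i, j) \<notin> M \<and> prefM mp i j then 1 - p * Y y j else 1))
      \<partial>Pi_pmf {..<n} [] (\<lambda>_. uniform_list n)) = (\<integral>\<^sup>+mp. (\<Prod>i<n. h i (mp i)) \<partial>Pi_pmf {..<n} [] (\<lambda>_. uniform_list n))"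
    by (simp add: h_def prefM_def)
  also have "\<dots> = (\<Prod>i<n. \<integral>\<^sup>+l. h i l \<partial>uniform_list n)"
    by (rule nn_integral_prod_Pi_pmf) simp
  also have "\<dots> = (\<Prod>i\<in>A. \<integral>\<^sup>+l. h i l \<partial>uniform_list n) * (\<Prod>i\<in>{..<n} - A. \<integral>\<^sup>+l. h i l \<partial>uniform_list n)"
    using finA by (subst split, subst prod.union_disjoint) auto
  also have "(\<Prod>i\<in>{..<n} - A. \<integral>\<^sup>+l. h i l \<partial>uniform_list n) = (\<Prod>j<n. ennreal (1 - p * Y y j)) ^ k"
    by (simp add: h0 card_rest)
  also have "(\<Prod>i\<in>A. \<integral>\<^sup>+l. h i l \<partial>uniform_list n) =
      (\<Prod>i\<in>A. \<integral>\<^sup>+x. (\<Prod>j<n. ennreal (if j \<noteq> f i then 1 - x * (p * Y y j) else 1)) \<partial>unif)"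
    by (intro prod.cong refl hA)
  finally show ?thesis .
qed

text \<open>Admissibility is averaged first, then the women's lists, then the men's. The integral
  over \<open>y\<close> is moved outside before the last step, because only for fixed
  \<open>y\<close> does the product split by men.\<close>

lemma emeasure_stable_le_cube_integral:
  "emeasure (sm_model n p) {I. stable_matching n I M} \<le> ennreal (p ^ card A) *
    (\<integral>\<^sup>+y. (\<Prod>i\<in>A. \<integral>\<^sup>+x. (\<Prod>j<n. ennreal (if j \<noteq> f i then 1 - x * (p * Y y j) else 1)) \<partial>unif) *
      (\<Prod>j<n. ennreal (1 - p * Y y j)) ^ k \<partial>cube)"
proof -
  let ?L = "Pi_pmf {..<n} [] (\<lambda>_. uniform_list n)"
  let ?D = "Pi_pmf ({..<n} \<times> {..<n}) False (\<lambda>_. bernoulli_pmf p)"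
  have fin: "finite (set_pmf ?L)"
    by (subst set_Pi_pmf) (auto intro!: finite_PiE_dflt)
  have "emeasure (sm_model n p) {I. stable_matching n I M} =
      (\<integral>\<^sup>+mp. \<integral>\<^sup>+wp. \<integral>\<^sup>+adm. indicator {I. stable_matching n I M} (mp, wp, adm) \<partial>?D \<partial>?L \<partial>?L)"
    unfolding sm_model_def by (subst nn_integral_indicator[symmetric]) (simp_all add: nn_integral_pair_pmf')
  also have "\<dots> = (\<integral>\<^sup>+mp. \<integral>\<^sup>+wp. emeasure ?D {adm. stable_matching n (mp, wp, adm) M} \<partial>?L \<partial>?L)"
  proof (intro nn_integral_cong)
    fix mp wp
    have "(\<integral>\<^sup>+adm. indicator {I. stable_matching n I M} (mp, wp, adm) \<partial>?D) =
        (\<integral>\<^sup>+adm. indicator {adm. stable_matching n (mp, wp, adm) M} adm \<partial>?D)"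
      by (intro nn_integral_cong) (simp add: indicator_def)
    then show "(\<integral>\<^sup>+adm. indicator {I. stable_matching n I M} (mp, wp, adm) \<partial>?D) =
        emeasure ?D {adm. stable_matching n (mp, wp, adm) M}"
      by simp
  qed
  also have "\<dots> \<le> (\<integral>\<^sup>+mp. \<integral>\<^sup>+wp. ennreal (p ^ card A) *
      (\<Prod>j<n. \<Prod>i<n. ennreal (if (i, j) \<notin> M \<and> prefM mp i j \<and> prefW wp i j then 1 - p else 1)) \<partial>?L \<partial>?L)"
    by (intro nn_integral_mono emeasure_admissible_stable)
  also have "\<dots> = ennreal (p ^ card A) * (\<integral>\<^sup>+mp. \<integral>\<^sup>+y.
      (\<Prod>i<n. \<Prod>j<n. ennreal (if (i, j) \<notin> M \<and> prefM mp i j then 1 - p * Y y j else 1)) \<partial>cube \<partial>?L)"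
    by (simp add: nn_integral_cmult nn_integral_women)
  also have "(\<integral>\<^sup>+mp. \<integral>\<^sup>+y.
      (\<Prod>i<n. \<Prod>j<n. ennreal (if (i, j) \<notin> M \<and> prefM mp i j then 1 - p * Y y j else 1)) \<partial>cube \<partial>?L) =
    (\<integral>\<^sup>+y. \<integral>\<^sup>+mp.
      (\<Prod>i<n. \<Prod>j<n. ennreal (if (i, j) \<notin> M \<and> prefM mp i j then 1 - p * Y y j else 1)) \<partial>?L \<partial>cube)"
    by (rule nn_integral_swap_finite_pmf[OF fin]) measurable
  also have "\<dots> = (\<integral>\<^sup>+y. (\<Prod>i\<in>A. \<integral>\<^sup>+x. (\<Prod>j<n. ennreal (if j \<noteq> f i then 1 - x * (p * Y y j) else 1)) \<partial>unif) *
      (\<Prod>j<n. ennreal (1 - p * Y y j)) ^ k \<partial>cube)"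
    by (intro nn_integral_cong nn_integral_men)
  finally show ?thesis .
qed


definition "t y = (\<Sum>j\<in>B. y j :: real)"

lemma cube_bounds: "y \<in> space cube \<Longrightarrow> j \<in> B \<Longrightarrow> 0 \<le> y j \<and> y j \<le> 1"
  using Y_bounds[of y j] by (simp add: Y_def)

lemma t_nonneg: "y \<in> space cube \<Longrightarrow> 0 \<le> t y"
  unfolding t_def by (intro sum_nonneg) (simp add: cube_bounds)

lemma t_measurable [measurable]: "t \<in> borel_measurable cube"
proof -
  have "t = (\<lambda>y. \<Sum>j\<in>B. Y y j)"
    by (simp add: t_def Y_def fun_eq_iff)
  then show ?thesis by simp
qed

lemma card_unmatched: "card ({..<n} - B) = k"
  using B finB by (simp add: card_Diff_subset cardB k_def)

lemma sum_Y: "(\<Sum>j<n. Y y j) = k + t y"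
proof -
  have "(\<Sum>j<n. Y y j) = (\<Sum>j\<in>{..<n} - B. Y y j) + (\<Sum>j\<in>B. Y y j)"
    using B by (intro sum.subset_diff) auto
  then show ?thesis
    by (simp add: Y_def t_def card_unmatched)
qed

lemma prod_unmatched_le:
  assumes "y \<in> space cube"
  shows "(\<Prod>j<n. 1 - p * Y y j) \<le> (1 - p) ^ k * exp (- (p * t y))"
proof -
  have "(\<Prod>j<n. 1 - p * Y y j) = (\<Prod>j\<in>{..<n} - B. 1 - p * Y y j) * (\<Prod>j\<in>B. 1 - p * Y y j)"
    using B by (intro prod.subset_diff) auto
  also have "\<dots> = (1 - p) ^ k * (\<Prod>j\<in>B. 1 - p * y j)"
    by (simp add: Y_def card_unmatched)
  also have "(\<Prod>j\<in>B. 1 - p * y j) \<le> exp (- (\<Sum>j\<in>B. p * y j))"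
    using p cube_bounds[OF assms] by (intro prod_one_minus_le_exp mult_le_one) auto
  finally show ?thesis
    using p by (simp add: t_def sum_distrib_left)
qed

text \<open>Pairs of two singles give \<open>(1 - p) ^ (k * k)\<close>; pairs of a single man and a
  matched woman give the exponential.\<close>

lemma prod_unmatched_pow_le:
  assumes "y \<in> space cube"
  shows "(\<Prod>j<n. ennreal (1 - p * Y y j)) ^ k \<le> ennreal ((1 - p) ^ (k * k) * exp (- (p * k * t y)))"
proof -
  have nonneg: "0 \<le> 1 - p * Y y j" for j
    using Y_bounds[OF assms, of j] p mult_le_one[of p "Y y j"] by auto
  have "(\<Prod>j<n. ennreal (1 - p * Y y j)) ^ k = ennreal ((\<Prod>j<n. 1 - p * Y y j) ^ k)"
    using nonneg by (simp add: prod_ennreal ennreal_power prod_nonneg)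
  also have "\<dots> \<le> ennreal (((1 - p) ^ k * exp (- (p * t y))) ^ k)"
    by (intro ennreal_leI power_mono prod_unmatched_le assms prod_nonneg nonneg)
  also have "((1 - p) ^ k * exp (- (p * t y))) ^ k = (1 - p) ^ (k * k) * exp (- (p * k * t y))"
    by (simp add: power_mult_distrib power_mult exp_of_nat_mult[symmetric] mult_ac)
  finally show ?thesis .
qed

text \<open>Only two facts are kept: the pairs of \<open>M\<close> are admissible and the
  \<open>k * k\<close> pairs of singles are not; all other factors are at most 1. This suffices when
  a positive fraction of the agents is single.\<close>

lemma emeasure_stable_le_trivial:
  "emeasure (sm_model n p) {I. stable_matching n I M} \<le> ennreal (p ^ card A * (1 - p) ^ (k * k))"
proof -
  have le1: "(\<integral>\<^sup>+x. (\<Prod>j<n. ennreal (if j \<noteq> f i then 1 - x * (p * Y y j) else 1)) \<partial>unif) \<le> 1"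
    if "y \<in> space cube" for y i
  proof -
    have "(\<integral>\<^sup>+x. (\<Prod>j<n. ennreal (if j \<noteq> f i then 1 - x * (p * Y y j) else 1)) \<partial>unif) \<le> (\<integral>\<^sup>+x. 1 \<partial>unif)"
      using Y_bounds[OF that] p
      by (intro nn_integral_mono prod_ennreal_le_1) (auto simp flip: ennreal_1 intro!: ennreal_leI)
    then show ?thesis
      using prob_space.emeasure_space_1[OF prob_space_unif] by simp
  qed
  have "emeasure (sm_model n p) {I. stable_matching n I M} \<le> ennreal (p ^ card A) *
      (\<integral>\<^sup>+y. ennreal ((1 - p) ^ (k * k)) \<partial>cube)"
  proof (intro order_trans[OF emeasure_stable_le_cube_integral] mult_left_mono nn_integral_mono)
    fix y assume y: "y \<in> space cube"
    have "(\<Prod>j<n. ennreal (1 - p * Y y j)) ^ k \<le> ennreal ((1 - p) ^ (k * k) * exp (- (p * k * t y)))"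
      by (rule prod_unmatched_pow_le[OF y])
    also have "\<dots> \<le> ennreal ((1 - p) ^ (k * k))"
      using p t_nonneg[OF y] by (intro ennreal_leI mult_left_le) auto
    finally have "(\<Prod>i\<in>A. \<integral>\<^sup>+x. (\<Prod>j<n. ennreal (if j \<noteq> f i then 1 - x * (p * Y y j) else 1)) \<partial>unif) *
        (\<Prod>j<n. ennreal (1 - p * Y y j)) ^ k \<le> 1 * ennreal ((1 - p) ^ (k * k))"
      by (intro mult_mono prod_ennreal_le_1) (auto intro: le1[OF y])
    then show "(\<Prod>i\<in>A. \<integral>\<^sup>+x. (\<Prod>j<n. ennreal (if j \<noteq> f i then 1 - x * (p * Y y j) else 1)) \<partial>unif) *
        (\<Prod>j<n. ennreal (1 - p * Y y j)) ^ k \<le> ennreal ((1 - p) ^ (k * k))"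
      by simp
  qed simp
  then show ?thesis
    using p by (simp add: emeasure_cube ennreal_mult)
qed

text \<open>The product is at most \<open>exp (- x * s)\<close> with
  \<open>s = p * (k + t y - y (f i))\<close>, since the \<open>Y y j\<close> add up to
  \<open>k + t y\<close> and the man's own partner is left out. The assumption
  \<open>1 \<le> k\<close> keeps the rate positive.\<close>

lemma nn_integral_man_le:
  assumes "y \<in> space cube" "i \<in> A" "1 \<le> k"
  shows "(\<integral>\<^sup>+x. (\<Prod>j<n. ennreal (if j \<noteq> f i then 1 - x * (p * Y y j) else 1)) \<partial>unif)
    \<le> ennreal (1 / (p * (k + t y - y (f i))))"
proof -
  have fi: "f i \<in> B" "f i < n"
    using assms(2) fA by (auto simp: B_def)
  have "y (f i) \<le> t y"
    unfolding t_def using fi finB cube_bounds[OF assms(1)] by (intro member_le_sum) auto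
  then have pos: "0 < p * (k + t y - y (f i))"
    using p assms(3) by simp
  have sum: "(\<Sum>j\<in>{..<n} - {f i}. x * (p * Y y j)) = x * (p * (k + t y - y (f i)))" for x
  proof -
    have "(\<Sum>j\<in>{..<n} - {f i}. Y y j) = k + t y - y (f i)"
      using fi sum.remove[of "{..<n}" "f i" "Y y"] sum_Y[of y] by (simp add: Y_def)
    then show ?thesis
      by (simp flip: sum_distrib_left)
  qed
  have "(\<integral>\<^sup>+x. (\<Prod>j<n. ennreal (if j \<noteq> f i then 1 - x * (p * Y y j) else 1)) \<partial>unif)
      \<le> (\<integral>\<^sup>+x. ennreal (exp (- (x * (p * (k + t y - y (f i)))))) \<partial>unif)"
  proof (intro nn_integral_mono)
    fix x assume x: "x \<in> space unif"
    have le1: "x * (p * Y y j) \<le> 1" for j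
      using x Y_bounds[OF assms(1), of j] p by (intro mult_le_one) auto
    have "(\<Prod>j<n. ennreal (if j \<noteq> f i then 1 - x * (p * Y y j) else 1)) =
        (\<Prod>j\<in>{..<n} - {f i}. ennreal (1 - x * (p * Y y j)))"
      using fi by (subst prod.remove[of _ "f i"]) (auto intro!: prod.cong)
    also have "\<dots> = ennreal (\<Prod>j\<in>{..<n} - {f i}. 1 - x * (p * Y y j))"
      using le1 by (intro prod_ennreal) auto
    also have "\<dots> \<le> ennreal (exp (- (x * (p * (k + t y - y (f i))))))"
      unfolding sum[symmetric] using le1 by (intro ennreal_leI prod_one_minus_le_exp)
    finally show "(\<Prod>j<n. ennreal (if j \<noteq> f i then 1 - x * (p * Y y j) else 1))
        \<le> ennreal (exp (- (x * (p * (k + t y - y (f i))))))" .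
  qed
  also have "\<dots> \<le> ennreal (1 / (p * (k + t y - y (f i))))"
    by (rule nn_integral_exp_unif_le[OF pos])
  finally show ?thesis .
qed

text \<open>The factor \<open>1 / p\<close> from each matched man cancels the
  \<open>p ^ card A\<close> for the admissibility of \<open>M\<close>. Removing \<open>y j\<close>
  from the denominators costs the constant \<open>exp 2\<close>.\<close>

lemma emeasure_stable_le_cube_integral':
  assumes "1 \<le> k"
  shows "emeasure (sm_model n p) {I. stable_matching n I M} \<le> ennreal ((1 - p) ^ (k * k) * exp 2) *
    (\<integral>\<^sup>+y. ennreal (exp (- (p * real k * t y)) / (real k + t y) ^ card A) \<partial>cube)"
proof -
  have "emeasure (sm_model n p) {I. stable_matching n I M} \<le> ennreal (p ^ card A) *
    (\<integral>\<^sup>+y. ennreal ((1 - p) ^ (k * k) * exp 2 / p ^ card A) * ennreal (exp (- (p * real k * t y)) / (real k + t y) ^ card A) \<partial>cube)"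
  proof (intro order_trans[OF emeasure_stable_le_cube_integral] mult_left_mono nn_integral_mono)
    fix y assume y: "y \<in> space cube"
    have le: "y j \<le> t y" if "j \<in> B" for j
      unfolding t_def using that finB cube_bounds[OF y] by (intro member_le_sum) auto
    have nonneg: "0 \<le> 1 / (p * (real k + t y - y j))" if "j \<in> B" for j
      using p le[OF that] by simp
    have "(\<Prod>i\<in>A. \<integral>\<^sup>+x. (\<Prod>j<n. ennreal (if j \<noteq> f i then 1 - x * (p * Y y j) else 1)) \<partial>unif)
        \<le> (\<Prod>i\<in>A. ennreal (1 / (p * (real k + t y - y (f i)))))"
      by (intro prod_mono_ennreal nn_integral_man_le y assms)
    also have "\<dots> = (\<Prod>j\<in>B. ennreal (1 / (p * (real k + t y - y j))))"
      unfolding B_def by (simp add: prod.reindex[OF inj])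
    also have "\<dots> = ennreal (\<Prod>j\<in>B. 1 / (p * (real k + t y - y j)))"
      by (intro prod_ennreal nonneg)
    also have "(\<Prod>j\<in>B. 1 / (p * (real k + t y - y j))) = 1 / p ^ card A * (\<Prod>j\<in>B. 1 / (real k + t y - y j))"
      by (simp add: prod_dividef prod.distrib cardB)
    also have "\<dots> \<le> 1 / p ^ card A * (exp 2 / (real k + t y) ^ card A)"
      using p finB assms cube_bounds[OF y] prod_inverse_sub_le[of B "real k" y]
      by (intro mult_left_mono) (auto simp: t_def cardB)
    finally have "(\<Prod>i\<in>A. \<integral>\<^sup>+x. (\<Prod>j<n. ennreal (if j \<noteq> f i then 1 - x * (p * Y y j) else 1)) \<partial>unif)
        \<le> ennreal (1 / p ^ card A * (exp 2 / (real k + t y) ^ card A))"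
      by (simp add: ennreal_leI)
    then have "(\<Prod>i\<in>A. \<integral>\<^sup>+x. (\<Prod>j<n. ennreal (if j \<noteq> f i then 1 - x * (p * Y y j) else 1)) \<partial>unif) *
        (\<Prod>j<n. ennreal (1 - p * Y y j)) ^ k \<le> ennreal (1 / p ^ card A * (exp 2 / (real k + t y) ^ card A)) *
        ennreal ((1 - p) ^ (k * k) * exp (- (p * real k * t y)))"
      by (intro mult_mono prod_unmatched_pow_le y) auto
    also have "\<dots> = ennreal ((1 - p) ^ (k * k) * exp 2 / p ^ card A) * ennreal (exp (- (p * real k * t y)) / (real k + t y) ^ card A)"
      using p t_nonneg[OF y] by (simp add: ennreal_mult[symmetric] mult_ac)
    finally show "(\<Prod>i\<in>A. \<integral>\<^sup>+x. (\<Prod>j<n. ennreal (if j \<noteq> f i then 1 - x * (p * Y y j) else 1)) \<partial>unif) *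
        (\<Prod>j<n. ennreal (1 - p * Y y j)) ^ k \<le>
        ennreal ((1 - p) ^ (k * k) * exp 2 / p ^ card A) * ennreal (exp (- (p * real k * t y)) / (real k + t y) ^ card A)" .
  qed simp
  also have "\<dots> = ennreal (p ^ card A) * ennreal ((1 - p) ^ (k * k) * exp 2 / p ^ card A) *
      (\<integral>\<^sup>+y. ennreal (exp (- (p * real k * t y)) / (real k + t y) ^ card A) \<partial>cube)"
    by (subst nn_integral_cmult) (simp_all add: mult.assoc)
  also have "ennreal (p ^ card A) * ennreal ((1 - p) ^ (k * k) * exp 2 / p ^ card A) = ennreal ((1 - p) ^ (k * k) * exp 2)"
    using p by (subst ennreal_mult[symmetric]) auto
  finally show ?thesis .
qed

text \<open>Once the negative power is a Gamma integral over \<open>u\<close>, the integrand depends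
  on \<open>y\<close> through \<open>exp (- (u + a) * t y)\<close>, a product over the coordinates.
  By Fubini each coordinate is integrated separately and gives at most
  \<open>1 / (u + a)\<close>.\<close>

lemma nn_integral_cube_le:
  assumes "0 < c" "0 < a" "card A = Suc r"
  shows "(\<integral>\<^sup>+y. ennreal (exp (- (a * t y)) / (c + t y) ^ card A) \<partial>cube) \<le>
    (\<integral>\<^sup>+u. ennreal (u ^ r * exp (- (c * u)) / (fact r * (u + a) ^ card A)) * indicator {0..} u \<partial>lborel)"
proof -
  interpret ps: pair_sigma_finite "lborel :: real measure" cube
    by (intro pair_sigma_finite.intro lborel.sigma_finite_measure_axioms cube.P.sigma_finite_measure_axioms)
  define K where "K u = ennreal (u ^ r * exp (- (c * u)) / fact r) * indicator {0..} u" for u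
  have K_meas [measurable]: "K \<in> borel_measurable borel"
    unfolding K_def by measurable
  have "(\<integral>\<^sup>+y. ennreal (exp (- (a * t y)) / (c + t y) ^ card A) \<partial>cube) =
      (\<integral>\<^sup>+y. \<integral>\<^sup>+u. K u * ennreal (exp (- ((u + a) * t y))) \<partial>lborel \<partial>cube)"
  proof (intro nn_integral_cong)
    fix y assume y: "y \<in> space cube"
    have "ennreal (exp (- (a * t y)) / (c + t y) ^ card A) = ennreal (exp (- (a * t y))) * ennreal (1 / (c + t y) ^ Suc r)"
      using assms t_nonneg[OF y] by (simp add: ennreal_mult[symmetric])
    also have "ennreal (1 / (c + t y) ^ Suc r) =
        (\<integral>\<^sup>+u. ennreal (u ^ r * exp (- ((c + t y) * u)) / fact r) * indicator {0..} u \<partial>lborel)"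
      using assms t_nonneg[OF y] by (intro nn_integral_gamma_kernel[symmetric]) auto
    also have "ennreal (exp (- (a * t y))) * \<dots> =
        (\<integral>\<^sup>+u. ennreal (exp (- (a * t y))) * (ennreal (u ^ r * exp (- ((c + t y) * u)) / fact r) * indicator {0..} u) \<partial>lborel)"
      by (rule nn_integral_cmult[symmetric]) measurable
    also have "\<dots> = (\<integral>\<^sup>+u. K u * ennreal (exp (- ((u + a) * t y))) \<partial>lborel)"
      by (intro nn_integral_cong)
        (auto simp: K_def ennreal_mult[symmetric] exp_add[symmetric] exp_minus field_simps split: split_indicator)
    finally show "ennreal (exp (- (a * t y)) / (c + t y) ^ card A) =
        (\<integral>\<^sup>+u. K u * ennreal (exp (- ((u + a) * t y))) \<partial>lborel)" .
  qed
  also have "\<dots> = (\<integral>\<^sup>+u. \<integral>\<^sup>+y. K u * ennreal (exp (- ((u + a) * t y))) \<partial>cube \<partial>lborel)"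
    by (rule ps.Fubini') measurable
  also have "\<dots> \<le> (\<integral>\<^sup>+u. ennreal (u ^ r * exp (- (c * u)) / (fact r * (u + a) ^ card A)) * indicator {0..} u \<partial>lborel)"
  proof (intro nn_integral_mono)
    fix u :: real
    show "(\<integral>\<^sup>+y. K u * ennreal (exp (- ((u + a) * t y))) \<partial>cube) \<le>
        ennreal (u ^ r * exp (- (c * u)) / (fact r * (u + a) ^ card A)) * indicator {0..} u"
    proof (cases "0 \<le> u")
      case True
      have "(\<integral>\<^sup>+y. ennreal (exp (- ((u + a) * t y))) \<partial>cube) = (\<integral>\<^sup>+y. (\<Prod>j\<in>B. ennreal (exp (- (y j * (u + a))))) \<partial>cube)"
        using finB by (intro nn_integral_cong) (simp add: t_def prod_ennreal exp_sum[symmetric] sum_distrib_left sum_negf mult.commute)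
      also have "\<dots> = (\<Prod>j\<in>B. \<integral>\<^sup>+v. ennreal (exp (- (v * (u + a)))) \<partial>unif)"
        by (rule cube.product_nn_integral_prod) (auto intro!: finB borel_measurable_unif)
      also have "\<dots> \<le> (\<Prod>j\<in>B. ennreal (1 / (u + a)))"
        using True assms by (intro prod_mono_ennreal nn_integral_exp_unif_le) auto
      also have "\<dots> = ennreal (1 / (u + a) ^ card A)"
        using True assms(1,2) by (simp add: cardB ennreal_power power_one_over)
      finally have "K u * (\<integral>\<^sup>+y. ennreal (exp (- ((u + a) * t y))) \<partial>cube) \<le> K u * ennreal (1 / (u + a) ^ card A)"
        by (intro mult_left_mono) auto
      also have "\<dots> = ennreal (u ^ r * exp (- (c * u)) / (fact r * (u + a) ^ card A)) * indicator {0..} u"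
        using True assms by (simp add: K_def ennreal_mult[symmetric])
      finally show ?thesis
        by (subst nn_integral_cmult) auto
    qed (simp add: K_def)
  qed
  finally show ?thesis .
qed

lemma emeasure_stable_le:
  assumes "1 \<le> k" "card A = Suc r"
  shows "emeasure (sm_model n p) {I. stable_matching n I M} \<le> ennreal ((1 - p) ^ (k * k) * exp 2) *
    (\<integral>\<^sup>+u. ennreal (u ^ r * exp (- (real k * u)) / (fact r * (u + p * real k) ^ Suc r)) * indicator {0..} u \<partial>lborel)"
  using emeasure_stable_le_cube_integral'[OF assms(1)] nn_integral_cube_le[of "real k" "p * k" r] assms p
  by (auto elim!: order_trans intro!: mult_left_mono)

end

subsection \<open>Explicit first moment bounds\<close>

text \<open>In terms of \<open>v = u + p * k\<close> the exponent contains
  \<open>r * p * k / v\<close> and \<open>k * v\<close>, whose product is free of \<open>v\<close>;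
  so the mean inequality bounds their sum uniformly in \<open>u\<close>. Passing from
  \<open>u\<close> to \<open>v\<close> costs \<open>exp (p * k * k)\<close>. One factor
  \<open>1 / v\<close> is kept for the integration.\<close>

lemma kernel_le:
  fixes u a k p :: real
  assumes "0 \<le> u" "0 < p" "0 < k"
  shows "u ^ r * exp (- (k * u)) / (u + p * k) ^ Suc r \<le>
    exp (p * k * k) * exp (- (2 * k * sqrt (real r * p))) * (1 / (u + p * k))"
proof -
  define v where "v = u + p * k"
  have v: "0 < v" using assms by (simp add: v_def add_nonneg_pos)
  have "u / v = 1 - p * k / v"
    using v by (simp add: field_simps v_def)
  also have "\<dots> \<le> exp (- (p * k / v))"
    using exp_ge_add_one_self[of "- (p * k / v)"] by simp
  finally have "(u / v) ^ r \<le> exp (- (p * k / v)) ^ r"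
    using v assms by (intro power_mono) auto
  then have ratio: "(u / v) ^ r \<le> exp (- (r * (p * k / v)))"
    by (simp flip: exp_of_nat_mult)
  have "2 * (k * sqrt (real r * p)) \<le> r * (p * k / v) + k * v"
  proof -
    have "sqrt ((r * (p * k / v)) * (k * v)) = k * sqrt (real r * p)"
      using v assms by (simp add: real_sqrt_mult)
    then show ?thesis
      using arith_geo_mean_sqrt[of "r * (p * k / v)" "k * v"] v assms by simp
  qed
  then have e: "- (r * (p * k / v)) + - (k * u) \<le> p * k * k + - (2 * k * sqrt (real r * p))"
    by (simp add: v_def algebra_simps)
  have "u ^ r * exp (- (k * u)) / v ^ Suc r = ((u / v) ^ r * exp (- (k * u))) * (1 / v)"
    by (simp add: power_divide)
  also have "\<dots> \<le> (exp (- (r * (p * k / v))) * exp (- (k * u))) * (1 / v)"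
    using ratio v by (intro mult_right_mono) auto
  also have "\<dots> \<le> (exp (p * k * k) * exp (- (2 * k * sqrt (real r * p)))) * (1 / v)"
    using v e by (intro mult_right_mono) (auto simp flip: exp_add)
  finally show ?thesis
    by (simp add: v_def)
qed

text \<open>The factor \<open>1 / (u + p * k)\<close> left by the pointwise bound is not integrable
  at infinity. That bound is therefore used only up to \<open>T\<close>, where it yields the
  logarithm; beyond \<open>T\<close> the decay of \<open>exp (- (k * u))\<close> suffices.\<close>

lemma kernel_integral_le:
  fixes k p T :: real
  assumes p: "0 < p" and k: "1 \<le> k" and T: "1 \<le> T"
  shows "(\<integral>\<^sup>+u. ennreal (u ^ r * exp (- (k * u)) / (fact r * (u + p * k) ^ Suc r)) * indicator {0..} u \<partial>lborel)
    \<le> ennreal ((exp (p * k * k) * exp (- (2 * k * sqrt (real r * p))) * ln (1 + T / (p * k)) + exp (- (k * T))) / fact r)"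
proof -
  let ?C = "exp (p * k * k) * exp (- (2 * k * sqrt (real r * p)))"
  let ?a = "p * k"
  have a: "0 < ?a" using p k by simp
  have log: "(\<integral>\<^sup>+u. ennreal (1 / (u + ?a)) * indicator {0..T} u \<partial>lborel) = ennreal (ln (1 + T / ?a))"
  proof -
    have "(\<integral>\<^sup>+u. ennreal (1 / (u + ?a)) * indicator {0..T} u \<partial>lborel) = ennreal (ln (T + ?a) - ln (0 + ?a))"
    proof (rule nn_integral_FTC_Icc)
      show "((\<lambda>u. ln (u + ?a)) has_real_derivative 1 / (u + ?a)) (at u)" if "u \<in> {0..T}" for u
        using that a by (auto intro!: derivative_eq_intros)
    qed (use a T in auto)
    also have "ln (T + ?a) - ln (0 + ?a) = ln (1 + T / ?a)"
    proof -
      have "1 + T / ?a = (T + ?a) / ?a"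
        using a p k by (simp add: field_simps)
      moreover have "T + ?a \<noteq> 0"
        using a T by linarith
      ultimately show ?thesis
        using p k by (simp add: ln_div)
    qed
    finally show ?thesis .
  qed
  have tail: "(\<integral>\<^sup>+u. ennreal (exp (- (k * u))) * indicator {T..} u \<partial>lborel) \<le> ennreal (exp (- (k * T)))"
  proof -
    have "(\<integral>\<^sup>+u. ennreal (exp (- (k * u))) * indicator {T..} u \<partial>lborel) = ennreal (0 - (- exp (- (k * T)) / k))"
    proof (rule nn_integral_FTC_atLeast)
      show "((\<lambda>u. - exp (- (k * u)) / k) has_real_derivative exp (- (k * u))) (at u)" for u
        using k by (auto intro!: derivative_eq_intros)
      show "((\<lambda>u. - exp (- (k * u)) / k) \<longlongrightarrow> 0) at_top"
        using k by real_asymp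
    qed auto
    also have "\<dots> \<le> ennreal (exp (- (k * T)))"
      using k by (intro ennreal_leI) (simp add: field_simps mult_left_mono)
    finally show ?thesis .
  qed
  have "(\<integral>\<^sup>+u. ennreal (u ^ r * exp (- (k * u)) / (fact r * (u + ?a) ^ Suc r)) * indicator {0..} u \<partial>lborel)
    \<le> (\<integral>\<^sup>+u. ennreal (?C / fact r) * (ennreal (1 / (u + ?a)) * indicator {0..T} u) +
        ennreal (1 / fact r) * (ennreal (exp (- (k * u))) * indicator {T..} u) \<partial>lborel)"
  proof (intro nn_integral_mono)
    fix u :: real
    let ?f = "u ^ r * exp (- (k * u)) / (fact r * (u + ?a) ^ Suc r)"
    consider "u < 0" | "0 \<le> u" "u \<le> T" | "T < u" by linarith
    then show "ennreal ?f * indicator {0..} u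
      \<le> ennreal (?C / fact r) * (ennreal (1 / (u + ?a)) * indicator {0..T} u) +
        ennreal (1 / fact r) * (ennreal (exp (- (k * u))) * indicator {T..} u)"
    proof cases
      case 2
      have "?f = (u ^ r * exp (- (k * u)) / (u + ?a) ^ Suc r) / fact r"
        by simp
      also have "\<dots> \<le> (?C * (1 / (u + ?a))) / fact r"
        using 2 p k by (intro divide_right_mono kernel_le) auto
      finally have "ennreal ?f \<le> ennreal (?C / fact r * (1 / (u + ?a)))"
        by (intro ennreal_leI) (simp add: mult.commute)
      also have "\<dots> = ennreal (?C / fact r) * ennreal (1 / (u + ?a))"
        using 2 a by (intro ennreal_mult) auto
      finally show ?thesis
        using 2 by (auto intro: add_increasing2)
    next
      case 3
      \<comment> \<open>Here \<open>1 \<le> T\<close> enters: the surplus factor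
        \<open>u + p * k\<close> is at least 1.\<close>
      have "u ^ r * 1 \<le> (u + ?a) ^ r * (u + ?a)"
        using 3 T a by (intro mult_mono power_mono) auto
      then have "u ^ r / (u + ?a) ^ Suc r \<le> 1"
        using 3 T a by (simp add: mult.commute)
      then have "(u ^ r / (u + ?a) ^ Suc r) * (exp (- (k * u)) / fact r) \<le> 1 * (exp (- (k * u)) / fact r)"
        by (intro mult_right_mono) auto
      then have "ennreal ?f \<le> ennreal (1 / fact r * exp (- (k * u)))"
        by (intro ennreal_leI) (simp add: mult.commute)
      also have "\<dots> = ennreal (1 / fact r) * ennreal (exp (- (k * u)))"
        by (intro ennreal_mult) auto
      finally show ?thesis
        using 3 T by simp
    qed simp
  qed
  also have "\<dots> = ennreal (?C / fact r) * ennreal (ln (1 + T / ?a)) +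
      ennreal (1 / fact r) * (\<integral>\<^sup>+u. ennreal (exp (- (k * u))) * indicator {T..} u \<partial>lborel)"
    by (simp add: nn_integral_add nn_integral_cmult log)
  also have "\<dots> \<le> ennreal (?C / fact r) * ennreal (ln (1 + T / ?a)) + ennreal (1 / fact r) * ennreal (exp (- (k * T)))"
    by (intro add_left_mono mult_left_mono tail) auto
  also have "\<dots> = ennreal (?C / fact r * ln (1 + T / ?a) + 1 / fact r * exp (- (k * T)))"
    using a T by (simp add: ennreal_mult[symmetric] ennreal_plus[symmetric] del: ennreal_plus)
  also have "?C / fact r * ln (1 + T / ?a) + 1 / fact r * exp (- (k * T)) = (?C * ln (1 + T / ?a) + exp (- (k * T))) / fact r"
    by (simp add: add_divide_distrib)
  finally show ?thesis .
qed

text \<open>The factor \<open>exp (p * k * k)\<close> lost in the mean inequality is absorbed by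
  \<open>(1 - p) ^ (k * k)\<close>, the probability that no two singles form an admissible
  pair.\<close>

lemma (in partial_matching) emeasure_stable_le_explicit:
  assumes "1 \<le> k" "card A = Suc r" "1 \<le> T"
  shows "emeasure (sm_model n p) {I. stable_matching n I M} \<le>
    ennreal (exp 2 * (exp (- (2 * real k * sqrt (real r * p))) * ln (1 + T / (p * real k)) + exp (- (real k * T))) / fact r)"
proof -
  let ?L = "ln (1 + T / (p * real k))"
  have L: "0 \<le> ?L"
    using p assms by (intro ln_ge_zero) auto
  have "emeasure (sm_model n p) {I. stable_matching n I M} \<le> ennreal ((1 - p) ^ (k * k) * exp 2) *
    ennreal ((exp (p * real k * real k) * exp (- (2 * real k * sqrt (real r * p))) * ?L + exp (- (real k * T))) / fact r)"
    using p assms by (intro order_trans[OF emeasure_stable_le[OF assms(1,2)]] mult_left_mono kernel_integral_le) auto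
  also have "\<dots> = ennreal ((1 - p) ^ (k * k) * exp 2 *
    ((exp (p * real k * real k) * exp (- (2 * real k * sqrt (real r * p))) * ?L + exp (- (real k * T))) / fact r))"
    using p L by (intro ennreal_mult[symmetric]) auto
  also have "\<dots> \<le> ennreal (exp 2 * (exp (- (2 * real k * sqrt (real r * p))) * ?L + exp (- (real k * T))) / fact r)"
  proof (intro ennreal_leI)
    have "(1 - p) ^ (k * k) \<le> exp (- p) ^ (k * k)"
      using p exp_ge_add_one_self[of "- p"] by (intro power_mono) auto
    also have "\<dots> = exp (- (p * real k * real k))"
      by (simp add: mult_ac flip: exp_of_nat_mult)
    finally have q: "(1 - p) ^ (k * k) * exp (p * real k * real k) \<le> 1"
      by (simp add: exp_minus field_simps)
    have q': "(1 - p) ^ (k * k) \<le> 1"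
      using p by (intro power_le_one) auto
    have "(1 - p) ^ (k * k) * (exp (p * real k * real k) * exp (- (2 * real k * sqrt (real r * p))) * ?L + exp (- (real k * T)))
      = ((1 - p) ^ (k * k) * exp (p * real k * real k)) * (exp (- (2 * real k * sqrt (real r * p))) * ?L)
        + (1 - p) ^ (k * k) * exp (- (real k * T))"
      by (simp add: algebra_simps)
    also have "\<dots> \<le> 1 * (exp (- (2 * real k * sqrt (real r * p))) * ?L) + 1 * exp (- (real k * T))"
      using q q' L by (intro add_mono mult_right_mono) auto
    finally have "(1 - p) ^ (k * k) * (exp (p * real k * real k) * exp (- (2 * real k * sqrt (real r * p))) * ?L + exp (- (real k * T)))
      \<le> exp (- (2 * real k * sqrt (real r * p))) * ?L + exp (- (real k * T))"
      by simp
    then have "exp 2 / fact r * ((1 - p) ^ (k * k) * (exp (p * real k * real k) * exp (- (2 * real k * sqrt (real r * p))) * ?L + exp (- (real k * T))))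
      \<le> exp 2 / fact r * (exp (- (2 * real k * sqrt (real r * p))) * ?L + exp (- (real k * T)))"
      by (intro mult_left_mono) auto
    then show "(1 - p) ^ (k * k) * exp 2 *
      ((exp (p * real k * real k) * exp (- (2 * real k * sqrt (real r * p))) * ?L + exp (- (real k * T))) / fact r)
      \<le> exp 2 * (exp (- (2 * real k * sqrt (real r * p))) * ?L + exp (- (real k * T))) / fact r"
      by (simp add: mult_ac)
  qed
  finally show ?thesis .
qed

section \<open>Counting matchings and the union bound\<close>

definition matching_codes :: "nat \<Rightarrow> nat \<Rightarrow> (nat set \<times> (nat \<Rightarrow> nat)) set" where
  "matching_codes n m = (SIGMA A:{A. A \<subseteq> {..<n} \<and> card A = m}. {f \<in> A \<rightarrow>\<^sub>E {..<n}. inj_on f A})"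

lemma falling_factorial_binomial: "prod ((-) n) {0..<m} = fact m * (n choose m)" for n m :: nat
proof (induction m)
  case (Suc m)
  have "(n - m) * (n choose m) = Suc m * (n choose Suc m)"
    by (metis binomial_absorb_comp binomial_absorption diff_Suc_1 mult.commute binomial_eq_0 diff_is_0_eq
        le_less_Suc_eq less_eq_Suc_le mult_0 mult_0_right not_less Suc_diff_1 zero_less_iff_neq_zero)
  then show ?case
    using Suc by (simp add: prod.atLeast0_lessThan_Suc algebra_simps)
qed simp

text \<open>There are \<open>n choose m\<close> sets of matched men and, for each,
  \<open>fact m * (n choose m)\<close> injections. Taking \<open>f\<close> undefined outside
  \<open>A\<close> is what makes the count finite.\<close>

lemma card_matching_codes: "card (matching_codes n m) = (n choose m)\<^sup>2 * fact m"
  and finite_matching_codes: "finite (matching_codes n m)"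
proof -
  let ?F = "\<lambda>A. {f \<in> A \<rightarrow>\<^sub>E {..<n}. inj_on f A}"
  have fin: "finite {A. A \<subseteq> {..<n} \<and> card A = m}"
    by (rule finite_subset[of _ "Pow {..<n}"]) auto
  have finF: "finite (?F A)" if "A \<subseteq> {..<n}" for A
    using finite_PiE[of A "\<lambda>_. {..<n}"] finite_subset[OF that] by auto
  show "finite (matching_codes n m)"
    unfolding matching_codes_def using fin finF by (intro finite_SigmaI) auto
  have cardF: "card (?F A) = fact m * (n choose m)" if "A \<subseteq> {..<n}" "card A = m" for A
    using card_inj_on_subset_funcset[of A "{..<n}" A] finite_subset[OF that(1)] that(2)
    by (simp add: falling_factorial_binomial)
  have "card (matching_codes n m) = (\<Sum>A\<in>{A. A \<subseteq> {..<n} \<and> card A = m}. card (?F A))"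
    unfolding matching_codes_def using fin finF by (intro card_SigmaI) auto
  also have "\<dots> = (n choose m) * (fact m * (n choose m))"
    by (simp add: cardF n_subsets)
  finally show "card (matching_codes n m) = (n choose m)\<^sup>2 * fact m"
    by (simp add: power2_eq_square)
qed

lemma matching_code_exists:
  assumes "matching n I M"
  obtains A f where "(A, f) \<in> matching_codes n (card M)" "M = (\<lambda>i. (i, f i)) ` A"
proof -
  have sub: "M \<subseteq> {..<n} \<times> {..<n}"
    and "\<forall>e\<in>M. \<forall>e'\<in>M. fst e = fst e' \<or> snd e = snd e' \<longrightarrow> e = e'"
    using assms unfolding matching_def case_prod_beta by blast+
  then have uniq: "e = e'" if "e \<in> M" "e' \<in> M" "fst e = fst e' \<or> snd e = snd e'" for e e'
    using that by blast
  define A where "A = fst ` M"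
  define f where "f = restrict (\<lambda>i. SOME w. (i, w) \<in> M) A"
  have f: "(i, f i) \<in> M" if i: "i \<in> A" for i
  proof -
    obtain w where "(i, w) \<in> M"
      using i by (auto simp: A_def)
    then have "(i, SOME w. (i, w) \<in> M) \<in> M"
      by (rule someI)
    then show ?thesis
      using that by (simp add: f_def)
  qed
  have M: "M = (\<lambda>i. (i, f i)) ` A"
  proof
    show "M \<subseteq> (\<lambda>i. (i, f i)) ` A"
    proof
      fix e assume e: "e \<in> M"
      then have "fst e \<in> A" by (simp add: A_def)
      then have "e = (fst e, f (fst e))"
        using uniq[OF e f[of "fst e"]] by simp
      then show "e \<in> (\<lambda>i. (i, f i)) ` A"
        using \<open>fst e \<in> A\<close> by blast
    qed
  qed (use f in auto)
  have inj: "inj_on f A"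
  proof (rule inj_onI)
    fix i j assume "i \<in> A" "j \<in> A" "f i = f j"
    then show "i = j"
      using uniq[OF f f, of i j] by simp
  qed
  have "card M = card A"
    unfolding M by (rule card_image) (auto simp: inj_on_def)
  moreover have "A \<subseteq> {..<n}" "f \<in> A \<rightarrow>\<^sub>E {..<n}"
    using sub f by (auto simp: A_def f_def PiE_def Pi_def extensional_def)
  ultimately have "(A, f) \<in> matching_codes n (card M)"
    using inj by (simp add: matching_codes_def)
  then show ?thesis
    using M that by blast
qed

text \<open>Union bound over the codes: any estimate valid for every single matching of size
  \<open>m\<close> is multiplied by their number.\<close>

lemma prob_stable_card_le:
  assumes p: "0 < p" "p < 1" and b: "0 \<le> b"
    and le: "\<And>A f. partial_matching n p A f \<Longrightarrow> card A = m \<Longrightarrow>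
      emeasure (sm_model n p) {I. stable_matching n I (partial_matching.M A f)} \<le> ennreal b"
  shows "measure_pmf.prob (sm_model n p) {I. \<exists>M. stable_matching n I M \<and> card M = m}
    \<le> (real (n choose m))\<^sup>2 * fact m * b"
proof -
  let ?E = "\<lambda>(A, f). {I. stable_matching n I ((\<lambda>i. (i, f i)) ` A)}"
  have "measure_pmf.prob (sm_model n p) {I. \<exists>M. stable_matching n I M \<and> card M = m}
      \<le> measure_pmf.prob (sm_model n p) (\<Union>c\<in>matching_codes n m. ?E c)"
  proof (intro measure_pmf.finite_measure_mono subsetI)
    fix I assume "I \<in> {I. \<exists>M. stable_matching n I M \<and> card M = m}"
    then obtain M where M: "stable_matching n I M" "card M = m" by blast
    then have "matching n I M"
      by (simp add: stable_matching_def)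
    then obtain A f where "(A, f) \<in> matching_codes n (card M)" "M = (\<lambda>i. (i, f i)) ` A"
      by (rule matching_code_exists)
    then show "I \<in> (\<Union>c\<in>matching_codes n m. ?E c)"
      using M by (intro UN_I[of "(A, f)"]) auto
  qed simp
  also have "\<dots> \<le> (\<Sum>c\<in>matching_codes n m. measure_pmf.prob (sm_model n p) (?E c))"
    by (intro measure_pmf.finite_measure_subadditive_finite finite_matching_codes) auto
  also have "\<dots> \<le> (\<Sum>c\<in>matching_codes n m. b)"
  proof (intro sum_mono)
    fix c assume c: "c \<in> matching_codes n m"
    obtain A f where c_eq: "c = (A, f)" by fastforce
    interpret partial_matching n p A f
      using c p by unfold_locales (auto simp: c_eq matching_codes_def)
    have "emeasure (sm_model n p) {I. stable_matching n I M} \<le> ennreal b"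
      using c by (intro le partial_matching_axioms) (simp add: c_eq matching_codes_def)
    then show "measure_pmf.prob (sm_model n p) (?E c) \<le> b"
      using b by (simp add: measure_pmf.emeasure_eq_measure c_eq M_def)
  qed
  also have "\<dots> = (real (n choose m))\<^sup>2 * fact m * b"
    by (simp add: card_matching_codes)
  finally show ?thesis .
qed

lemma prob_stable_card_le_main:
  assumes p: "0 < p" "p < 1" and "1 \<le> k" "k < n" and T: "1 \<le> T"
  shows "measure_pmf.prob (sm_model n p) {I. \<exists>M. stable_matching n I M \<and> card M = n - k}
    \<le> exp 2 * real n * (real (n choose k))\<^sup>2 *
      (exp (- (2 * real k * sqrt (real (n - k - 1) * p))) * ln (1 + T / (p * real k)) + exp (- (real k * T)))"
proof -
  define r where "r = n - k - 1"
  have m: "n - k = Suc r" "n - Suc r = k"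
    using assms by (auto simp: r_def)
  let ?E = "exp (- (2 * real k * sqrt (real r * p))) * ln (1 + T / (p * real k)) + exp (- (real k * T))"
  have L: "0 \<le> ln (1 + T / (p * real k))"
    using p assms by (intro ln_ge_zero) auto
  have "measure_pmf.prob (sm_model n p) {I. \<exists>M. stable_matching n I M \<and> card M = n - k}
    \<le> (real (n choose (n - k)))\<^sup>2 * fact (n - k) * (exp 2 * ?E / fact r)"
  proof (rule prob_stable_card_le[OF p])
    show "0 \<le> exp 2 * ?E / fact r"
      using L by simp
    fix A f assume "partial_matching n p A f" and cA: "card A = n - k"
    then interpret partial_matching n p A f by simp
    have "local.k = k"
      using m by (simp add: k_def cA)
    then show "emeasure (sm_model n p) {I. stable_matching n I M} \<le> ennreal (exp 2 * ?E / fact r)"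
      using emeasure_stable_le_explicit[of r T] assms(3) T m cA by simp
  qed
  \<comment> \<open>Of the two factorials only \<open>fact (n - k) / fact r = Suc r\<close>
    survives, the source of the factor \<open>n\<close> in the final bound.\<close>
  also have "\<dots> = exp 2 * real (Suc r) * (real (n choose k))\<^sup>2 * ?E"
    using assms by (simp add: m(1) binomial_symmetric[of k n] divide_simps del: of_nat_Suc)
  also have "\<dots> \<le> exp 2 * real n * (real (n choose k))\<^sup>2 * ?E"
    using L m(1) by (intro mult_right_mono mult_left_mono) auto
  finally show ?thesis
    by (simp add: r_def)
qed

lemma prob_stable_card_le_trivial:
  assumes p: "0 < p" "p < 1" and "k \<le> n"
  shows "measure_pmf.prob (sm_model n p) {I. \<exists>M. stable_matching n I M \<and> card M = n - k}
    \<le> (real (n choose k))\<^sup>2 * fact (n - k) * (p ^ (n - k) * (1 - p) ^ (k * k))"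
proof -
  have "measure_pmf.prob (sm_model n p) {I. \<exists>M. stable_matching n I M \<and> card M = n - k}
    \<le> (real (n choose (n - k)))\<^sup>2 * fact (n - k) * (p ^ (n - k) * (1 - p) ^ (k * k))"
  proof (rule prob_stable_card_le[OF p])
    show "0 \<le> p ^ (n - k) * (1 - p) ^ (k * k)"
      using p by simp
    fix A f assume "partial_matching n p A f" and cA: "card A = n - k"
    then interpret partial_matching n p A f by simp
    have "local.k = k"
      using assms(3) by (simp add: k_def cA)
    then show "emeasure (sm_model n p) {I. stable_matching n I M} \<le> ennreal (p ^ (n - k) * (1 - p) ^ (k * k))"
      using emeasure_stable_le_trivial cA by simp
  qed
  then show ?thesis
    using assms(3) by (simp add: binomial_symmetric[of k n])
qed

subsection \<open>Asymptotics\<close>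

lemma binomial_sq_le_exp:
  assumes "0 < n"
  shows "(real (n choose k))\<^sup>2 \<le> exp (2 * real k * ln (real n))"
proof -
  have "real (n choose k) \<le> real (n ^ k)"
    by (cases "k \<le> n") (auto simp: binomial_le_pow binomial_eq_0)
  also have "real (n ^ k) = exp (real k * ln (real n))"
    using assms by (simp add: exp_of_nat_mult)
  finally have "(real (n choose k))\<^sup>2 \<le> (exp (real k * ln (real n)))\<^sup>2"
    by (intro power_mono) auto
  also have "\<dots> = exp (2 * real k * ln (real n))"
    by (simp add: exp_double[symmetric] mult.assoc)
  finally show ?thesis .
qed

text \<open>The exponent \<open>2 k s L - 2 k L\<close> with \<open>L = ln n\<close> is where the threshold on \<open>c\<close> comes from:
  it has to exceed \<open>L\<close> in order to beat the remaining factor \<open>n\<close>.\<close>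

lemma prob_stable_few_unmatched_le:
  fixes n k :: nat and p \<eta> s c :: real
  defines "L \<equiv> ln (real n)"
  assumes p: "p < 1" "c * L\<^sup>2 / n \<le> p" and L: "1 \<le> L" and c: "1 \<le> c" "s\<^sup>2 \<le> c * (1 - 2 * \<eta>)" and s: "0 \<le> s"
    and k: "1 \<le> k" "k \<le> \<eta> * n" "1 \<le> \<eta> * n" "k < n"
  shows "measure_pmf.prob (sm_model n p) {I. \<exists>M. stable_matching n I M \<and> card M = n - k}
    \<le> exp 2 * n * (exp (- (2 * (s - 1) * L)) ^ k * ln (1 + 6 * real n) + exp (- (4 * L)))"
proof -
  have n: "0 < n" using k by simp
  have "0 < c * L\<^sup>2 / n"
    using c L n by simp
  then have p0: "0 < p" using p by linarith
  have np: "c * L\<^sup>2 \<le> n * p"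
    using p(2) n by (simp add: field_simps)
  have "s * L \<le> sqrt (real (n - k - 1) * p)"
  proof (rule real_le_rsqrt)
    have "(s * L)\<^sup>2 \<le> (1 - 2 * \<eta>) * (c * L\<^sup>2)"
      using mult_right_mono[OF c(2), of "L\<^sup>2"] by (simp add: power_mult_distrib mult_ac)
    also have "\<dots> \<le> (1 - 2 * \<eta>) * (n * p)"
    proof (intro mult_left_mono np)
      have "0 \<le> c * (1 - 2 * \<eta>)"
        using c(2) zero_le_power2[of s] by linarith
      then show "0 \<le> 1 - 2 * \<eta>"
        using c(1) by (simp add: zero_le_mult_iff)
    qed
    also have "\<dots> = (n - 2 * \<eta> * n) * p"
      by (simp add: algebra_simps)
    \<comment> \<open>Adding \<open>k \<le> \<eta> * n\<close> and \<open>1 \<le> \<eta> * n\<close>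
      gives \<open>k + 1 \<le> 2 * \<eta> * n\<close>.\<close>
    also have "\<dots> \<le> real (n - k - 1) * p"
      using k p0 by (intro mult_right_mono) (auto simp: of_nat_diff)
    finally show "(s * L)\<^sup>2 \<le> real (n - k - 1) * p" .
  qed
  then have "exp (- (2 * real k * sqrt (real (n - k - 1) * p))) \<le> exp (- (2 * real k * (s * L)))"
    by (simp add: mult_left_mono)
  \<comment> \<open>The cut is placed at \<open>T = 6 * L\<close>; since \<open>n * p\<close> is at
    least \<open>L\<close>, the argument of the logarithm stays linear in \<open>n\<close>.\<close>
  moreover have "ln (1 + 6 * L / (p * k)) \<le> ln (1 + 6 * real n)"
  proof -
    have "L * 1 \<le> c * L\<^sup>2"
      using c L mult_mono[of 1 c L "L * L"] by (simp add: power2_eq_square)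
    then have "L \<le> n * p"
      using np by simp
    also have "\<dots> \<le> n * p * k"
      using k p0 mult_left_mono[of 1 "real k" "n * p"] by simp
    finally have "6 * L / (p * k) \<le> 6 * n"
      using p0 k by (simp add: field_simps)
    moreover have "0 \<le> 6 * L / (p * k)"
      using p0 L by simp
    ultimately show ?thesis
      by (subst ln_le_cancel_iff) (auto intro: add_pos_nonneg)
  qed
  moreover have "0 \<le> ln (1 + 6 * L / (p * k))"
    using p0 L by (intro ln_ge_zero) simp
  ultimately have main: "exp (- (2 * real k * sqrt (real (n - k - 1) * p))) * ln (1 + 6 * L / (p * k))
      \<le> exp (- (2 * real k * (s * L))) * ln (1 + 6 * real n)"
    by (intro mult_mono) auto
  \<comment> \<open>The cut \<open>6 * L\<close> makes the tail \<open>exp (- 6 * k * L)\<close>.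
    Against the squared binomial \<open>exp (2 * k * L)\<close> this leaves at most
    \<open>exp (- 4 * L)\<close>, that is \<open>n\<close> to the power -4, which still beats the
    factor \<open>n\<close> and a sum over \<open>k\<close>.\<close>
  have "measure_pmf.prob (sm_model n p) {I. \<exists>M. stable_matching n I M \<and> card M = n - k}
    \<le> exp 2 * n * (real (n choose k))\<^sup>2 *
      (exp (- (2 * real k * sqrt (real (n - k - 1) * p))) * ln (1 + 6 * L / (p * k)) + exp (- (k * (6 * L))))"
    using p0 p(1) k L by (intro prob_stable_card_le_main) auto
  also have "\<dots> \<le> exp 2 * n * (real (n choose k))\<^sup>2 *
      (exp (- (2 * real k * (s * L))) * ln (1 + 6 * real n) + exp (- (k * (6 * L))))"
    using main by (intro mult_left_mono add_right_mono) auto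
  also have "\<dots> \<le> exp 2 * n * exp (2 * k * L) *
      (exp (- (2 * real k * (s * L))) * ln (1 + 6 * real n) + exp (- (k * (6 * L))))"
    using binomial_sq_le_exp[OF n, of k] by (intro mult_right_mono mult_left_mono) (auto simp: L_def)
  also have "\<dots> = exp 2 * n * (exp (2 * k * L) * exp (- (2 * real k * (s * L))) * ln (1 + 6 * real n)
      + exp (2 * k * L) * exp (- (k * (6 * L))))"
    by (simp add: algebra_simps)
  also have "exp (2 * k * L) * exp (- (2 * real k * (s * L))) = exp (- (2 * (s - 1) * L)) ^ k"
    by (simp add: exp_add[symmetric] exp_of_nat_mult[symmetric] algebra_simps)
  also have "exp (2 * k * L) * exp (- (k * (6 * L))) = exp (- (4 * k * L))"
    by (simp add: exp_add[symmetric] algebra_simps)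
  also have "exp 2 * n * (exp (- (2 * (s - 1) * L)) ^ k * ln (1 + 6 * real n) + exp (- (4 * k * L)))
      \<le> exp 2 * n * (exp (- (2 * (s - 1) * L)) ^ k * ln (1 + 6 * real n) + exp (- (4 * L)))"
    using k L by (intro mult_left_mono add_left_mono) auto
  finally show ?thesis .
qed

text \<open>There are at most \<open>4 ^ n * fact (n - k)\<close> matchings of this size. With
  \<open>p ^ (n - k)\<close> this is at most \<open>4 ^ n * (n * p) ^ n\<close>, while the pairs of
  singles contribute \<open>exp (- n * \<eta>^2 * n * p)\<close>, which wins once
  \<open>n * p\<close> is large.\<close>

lemma prob_stable_many_unmatched_le:
  fixes n k :: nat and p \<eta> :: real
  assumes p: "0 < p" "p < 1" and q: "1 \<le> n * p" "ln 4 + ln (n * p) - \<eta>\<^sup>2 * (n * p) \<le> - 1"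
    and \<eta>: "0 \<le> \<eta>" and k: "\<eta> * n \<le> k" "k \<le> n"
  shows "measure_pmf.prob (sm_model n p) {I. \<exists>M. stable_matching n I M \<and> card M = n - k} \<le> exp (- real n)"
proof -
  have "real (n choose k) \<le> real (2 ^ n)"
    by (intro of_nat_mono binomial_le_pow2)
  then have "(real (n choose k))\<^sup>2 \<le> (2 ^ n)\<^sup>2"
    by (intro power_mono) auto
  also have "((2::real) ^ n)\<^sup>2 = (2\<^sup>2) ^ n"
    by (simp only: power_mult[symmetric] mult.commute)
  finally have choose: "(real (n choose k))\<^sup>2 \<le> 4 ^ n"
    by simp
  have "fact (n - k) * p ^ (n - k) \<le> real (n ^ (n - k)) * p ^ (n - k)"
  proof (intro mult_right_mono)
    have "fact (n - k) \<le> (n - k) ^ (n - k)"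
      using fact_le_power[of "n - k", where 'a=nat] by simp
    also have "\<dots> \<le> n ^ (n - k)"
      by (intro power_mono) auto
    finally show "fact (n - k) \<le> real (n ^ (n - k))"
      by (metis of_nat_fact of_nat_le_iff)
  qed (use p in auto)
  also have "\<dots> = (n * p) ^ (n - k)"
    by (simp add: power_mult_distrib)
  also have "\<dots> \<le> (n * p) ^ n"
    using q by (intro power_increasing) auto
  finally have fact: "fact (n - k) * p ^ (n - k) \<le> (n * p) ^ n" .
  have "(1 - p) ^ (k * k) \<le> exp (- p) ^ (k * k)"
    using p exp_ge_add_one_self[of "- p"] by (intro power_mono) auto
  also have "\<dots> = exp (- (p * (real k)\<^sup>2))"
    by (simp add: power2_eq_square mult_ac flip: exp_of_nat_mult)
  also have "\<dots> \<le> exp (- (p * (\<eta> * n)\<^sup>2))"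
    using p \<eta> k by (simp add: power_mono)
  finally have tail: "(1 - p) ^ (k * k) \<le> exp (- (p * (\<eta> * n)\<^sup>2))" .
  have "measure_pmf.prob (sm_model n p) {I. \<exists>M. stable_matching n I M \<and> card M = n - k}
    \<le> (real (n choose k))\<^sup>2 * fact (n - k) * (p ^ (n - k) * (1 - p) ^ (k * k))"
    by (rule prob_stable_card_le_trivial[OF p k(2)])
  also have "\<dots> = (real (n choose k))\<^sup>2 * ((fact (n - k) * p ^ (n - k)) * (1 - p) ^ (k * k))"
    by (simp add: mult_ac)
  also have "\<dots> \<le> 4 ^ n * ((n * p) ^ n * exp (- (p * (\<eta> * n)\<^sup>2)))"
    using p q by (intro mult_mono choose fact tail) auto
  also have "\<dots> = exp (n * (ln 4 + ln (n * p) - \<eta>\<^sup>2 * (n * p)))"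
  proof -
    have "(4::real) ^ n = exp (n * ln 4)" "(n * p) ^ n = exp (n * ln (n * p))"
      using q by (simp_all add: exp_of_nat_mult)
    then show ?thesis
      by (simp add: exp_add[symmetric] algebra_simps power2_eq_square)
  qed
  also have "\<dots> \<le> exp (- real n)"
    using mult_left_mono[OF q(2), of "real n"] by simp
  finally show ?thesis .
qed

lemma prob_unmatched_le_sum:
  "measure_pmf.prob (sm_model n p) {I. \<exists>M. stable_matching n I M \<and> card M + d \<le> n}
    \<le> (\<Sum>k=d..n. measure_pmf.prob (sm_model n p) {I. \<exists>M. stable_matching n I M \<and> card M = n - k})"
proof -
  have "measure_pmf.prob (sm_model n p) {I. \<exists>M. stable_matching n I M \<and> card M + d \<le> n}
    \<le> measure_pmf.prob (sm_model n p) (\<Union>k\<in>{d..n}. {I. \<exists>M. stable_matching n I M \<and> card M = n - k})"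
  proof (intro measure_pmf.finite_measure_mono subsetI)
    fix I assume "I \<in> {I. \<exists>M. stable_matching n I M \<and> card M + d \<le> n}"
    then obtain M where "stable_matching n I M" "card M + d \<le> n" by blast
    then show "I \<in> (\<Union>k\<in>{d..n}. {I. \<exists>M. stable_matching n I M \<and> card M = n - k})"
      by (intro UN_I[of "n - card M"]) auto
  qed simp
  also have "\<dots> \<le> (\<Sum>k=d..n. measure_pmf.prob (sm_model n p) {I. \<exists>M. stable_matching n I M \<and> card M = n - k})"
    by (intro measure_pmf.finite_measure_subadditive_finite) auto
  finally show ?thesis .
qed

text \<open>The sum over \<open>k\<close> is split at \<open>\<eta> * n\<close>. Below, the main
  terms form a geometric series of ratio \<open>\<rho> \<le> 1 / 2\<close>, hence at most twice the
  term \<open>k = d\<close>; all other errors are uniform in \<open>k\<close> and are summed at most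
  \<open>n + 1\<close> times.\<close>

lemma prob_unmatched_le:
  fixes n d :: nat and p \<eta> s c :: real
  defines "L \<equiv> ln (real n)"
  defines "\<rho> \<equiv> exp (- (2 * (s - 1) * L))"
  assumes p: "p < 1" "c * L\<^sup>2 / n \<le> p" and L: "1 \<le> L" and c: "1 \<le> c" "s\<^sup>2 \<le> c * (1 - 2 * \<eta>)" and s: "0 \<le> s"
    and \<eta>: "0 \<le> \<eta>" "1 \<le> \<eta> * n" and d: "1 \<le> d" and \<rho>: "\<rho> \<le> 1 / 2"
    and q: "ln 4 + ln (n * p) - \<eta>\<^sup>2 * (n * p) \<le> - 1"
  shows "measure_pmf.prob (sm_model n p) {I. \<exists>M. stable_matching n I M \<and> card M + d \<le> n}
    \<le> 2 * exp 2 * n * ln (1 + 6 * real n) * \<rho> ^ d + (n + 1) * (exp 2 * n * exp (- (4 * L)) + exp (- real n))"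
proof -
  have n: "0 < n"
    using \<eta>(2) by (cases n) auto
  have np: "c * L\<^sup>2 \<le> n * p"
    using p(2) n by (simp add: field_simps)
  have "1 * 1\<^sup>2 \<le> c * L\<^sup>2"
    using c L by (intro mult_mono power_mono) auto
  then have np1: "1 \<le> n * p" using np by simp
  then have p0: "0 < p"
    using n by (metis less_le_trans zero_less_mult_pos zero_less_one of_nat_0_less_iff)
  have \<rho>0: "0 < \<rho>" by (simp add: \<rho>_def)
  have ln0: "0 \<le> ln (1 + 6 * real n)" by simp
  have summand: "measure_pmf.prob (sm_model n p) {I. \<exists>M. stable_matching n I M \<and> card M = n - k}
      \<le> exp 2 * n * ln (1 + 6 * real n) * \<rho> ^ k + (exp 2 * n * exp (- (4 * L)) + exp (- real n))"
    if k: "k \<in> {d..n}" for k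
  proof (cases "k \<le> \<eta> * n \<and> k < n")
    case True
    then have "measure_pmf.prob (sm_model n p) {I. \<exists>M. stable_matching n I M \<and> card M = n - k}
        \<le> exp 2 * n * (\<rho> ^ k * ln (1 + 6 * real n) + exp (- (4 * L)))"
      unfolding \<rho>_def L_def using p c s k d \<eta> L
      by (intro prob_stable_few_unmatched_le[where c=c and \<eta>=\<eta>]) (auto simp: L_def)
    also have "\<dots> = exp 2 * n * ln (1 + 6 * real n) * \<rho> ^ k + exp 2 * n * exp (- (4 * L))"
      by (simp add: algebra_simps)
    finally show ?thesis
      using exp_ge_zero[of "- real n"] by linarith
  next
    case False
    \<comment> \<open>The empty matching, \<open>k = n\<close>, is handled here too: it satisfies
      \<open>\<eta> * n \<le> k\<close> because \<open>\<eta> \<le> 1\<close>.\<close>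
    have "0 \<le> c * (1 - 2 * \<eta>)"
      using c(2) zero_le_power2[of s] by linarith
    then have "\<eta> \<le> 1"
      using c(1) by (simp add: zero_le_mult_iff)
    then have "\<eta> * n \<le> n"
      using mult_right_mono[of \<eta> 1 "real n"] by simp
    then have "measure_pmf.prob (sm_model n p) {I. \<exists>M. stable_matching n I M \<and> card M = n - k} \<le> exp (- real n)"
      using False k by (intro prob_stable_many_unmatched_le[OF p0 p(1) np1 q \<eta>(1)]) auto
    moreover have "0 \<le> exp 2 * n * ln (1 + 6 * real n) * \<rho> ^ k"
      using ln0 \<rho>0 by (intro mult_nonneg_nonneg) auto
    moreover have "0 \<le> exp 2 * n * exp (- (4 * L))"
      by simp
    ultimately show ?thesis by linarith
  qed
  have "(\<Sum>k=d..n. \<rho> ^ k) \<le> 2 * \<rho> ^ d"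
  proof -
    have "(\<Sum>k=d..n. \<rho> ^ k) \<le> \<rho> ^ d / (1 - \<rho>)"
      using \<rho>0 \<rho> by (auto simp: sum_gp divide_right_mono)
    also have "\<dots> \<le> \<rho> ^ d / (1 / 2)"
      using \<rho>0 \<rho> by (intro divide_left_mono) auto
    finally show ?thesis by simp
  qed
  then have geo: "exp 2 * n * ln (1 + 6 * real n) * (\<Sum>k=d..n. \<rho> ^ k) \<le> exp 2 * n * ln (1 + 6 * real n) * (2 * \<rho> ^ d)"
    using ln0 by (intro mult_left_mono) auto
  have "measure_pmf.prob (sm_model n p) {I. \<exists>M. stable_matching n I M \<and> card M + d \<le> n}
      \<le> (\<Sum>k=d..n. exp 2 * n * ln (1 + 6 * real n) * \<rho> ^ k + (exp 2 * n * exp (- (4 * L)) + exp (- real n)))"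
    by (intro order_trans[OF prob_unmatched_le_sum] sum_mono summand)
  also have "\<dots> = exp 2 * n * ln (1 + 6 * real n) * (\<Sum>k=d..n. \<rho> ^ k) +
      card {d..n} * (exp 2 * n * exp (- (4 * L)) + exp (- real n))"
    by (simp add: sum.distrib sum_distrib_left)
  also have "\<dots> \<le> exp 2 * n * ln (1 + 6 * real n) * (2 * \<rho> ^ d) + (n + 1) * (exp 2 * n * exp (- (4 * L)) + exp (- real n))"
    using geo by (intro add_mono mult_right_mono) auto
  finally show ?thesis
    by (simp add: mult_ac)
qed

lemma prob_unmatched_tendsto_0:
  fixes p :: "nat \<Rightarrow> real" and c :: real and d :: nat
  assumes d: "1 \<le> d" and c: "(1 + 1 / (2 * real d))\<^sup>2 < c"
    and p: "\<forall>\<^sub>F n in sequentially. 0 < p n \<and> p n < 1"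
    and pc: "\<forall>\<^sub>F n in sequentially. p n \<ge> c * (ln (real n))\<^sup>2 / real n"
  shows "(\<lambda>n. measure_pmf.prob (sm_model n (p n)) {I. \<exists>M. stable_matching n I M \<and> card M + d \<le> n}) \<longlonglongrightarrow> 0"
proof -
  have "1 < (1 + 1 / (2 * real d))\<^sup>2"
    using d by (intro one_less_power) auto
  then have c0: "1 < c"
    using c by linarith
  have "1 + 1 / (2 * real d) < sqrt c"
    using c by (intro real_less_rsqrt)
  \<comment> \<open>The lower bound on \<open>s\<close> makes \<open>\<rho> ^ d\<close> smaller than
    \<open>1 / n\<close> by a power of \<open>n\<close>; the gap up to \<open>sqrt c\<close> pays
    for replacing \<open>n\<close> by \<open>n - k - 1\<close>.\<close>
  then obtain s where s: "1 + 1 / (2 * real d) < s" "s < sqrt c"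
    using dense by blast
  have s1: "1 < s"
    using s(1) d by (smt (verit) divide_pos_pos of_nat_0_less_iff less_le_trans zero_less_one)
  have "s\<^sup>2 < (sqrt c)\<^sup>2"
    using s s1 by (intro power_strict_mono) auto
  then have sc: "s\<^sup>2 < c"
    using c0 by simp
  \<comment> \<open>Chosen so that \<open>c * (1 - 2 * \<eta>)\<close> equals
    \<open>s\<^sup>2\<close>.\<close>
  define \<eta> where "\<eta> = (1 - s\<^sup>2 / c) / 2"
  have \<eta>: "0 < \<eta>" "s\<^sup>2 \<le> c * (1 - 2 * \<eta>)"
    using sc c0 by (auto simp: \<eta>_def field_simps)
  \<comment> \<open>The power of \<open>n\<close> to spare: with
    \<open>\<rho> = exp (- (2 * (s - 1) * ln n))\<close>, the product \<open>n * \<rho> ^ d\<close>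
    equals \<open>n powr (- b)\<close>.\<close>
  define b where "b = 2 * (s - 1) * d - 1"
  have b: "0 < b"
    using s(1) d by (simp add: b_def field_simps)
  \<comment> \<open>Condition of the estimate for many singles, with \<open>q = n * p n\<close>,
    which tends to infinity as it is at least \<open>c * (ln n)\<^sup>2\<close>.\<close>
  have "\<forall>\<^sub>F q :: real in at_top. ln 4 + ln q - \<eta>\<^sup>2 * q \<le> - 1"
    using \<eta>(1) by real_asymp
  then obtain Q where Q: "\<And>q. Q \<le> q \<Longrightarrow> ln 4 + ln q - \<eta>\<^sup>2 * q \<le> - 1"
    by (auto simp: eventually_at_top_linorder)
  let ?bound = "\<lambda>n::nat. 2 * exp 2 * n * ln (1 + 6 * real n) * exp (- ((1 + b) * ln n)) +
      (n + 1) * (exp 2 * n * exp (- (4 * ln n)) + exp (- real n))"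
  have lim: "?bound \<longlonglongrightarrow> 0"
  proof -
    have "(\<lambda>n::nat. 2 * exp 2 * ln (1 + 6 * real n) * real n powr (- b)) \<longlonglongrightarrow> 0"
      using b by real_asymp
    moreover have "\<forall>\<^sub>F n::nat in sequentially. 2 * exp 2 * ln (1 + 6 * real n) * real n powr (- b) =
        2 * exp 2 * n * ln (1 + 6 * real n) * exp (- ((1 + b) * ln n))"
      using eventually_gt_at_top[of 0]
    proof eventually_elim
      case (elim n)
      then have "real n powr (- b) = n * exp (- ((1 + b) * ln n))"
        by (simp add: powr_def distrib_right exp_diff exp_minus inverse_eq_divide)
      then show ?case by simp
    qed
    ultimately have "(\<lambda>n::nat. 2 * exp 2 * n * ln (1 + 6 * real n) * exp (- ((1 + b) * ln n))) \<longlonglongrightarrow> 0"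
      by (rule Lim_transform_eventually)
    moreover have "(\<lambda>n::nat. (n + 1) * (exp 2 * n * exp (- (4 * ln n)) + exp (- real n))) \<longlonglongrightarrow> 0"
      by real_asymp
    ultimately show ?thesis
      by (rule tendsto_add_zero)
  qed
  have e1: "\<forall>\<^sub>F n::nat in sequentially. 1 \<le> ln n"
    by real_asymp
  have e2: "\<forall>\<^sub>F n::nat in sequentially. 1 \<le> \<eta> * n"
    using \<eta>(1) by real_asymp
  have e3: "\<forall>\<^sub>F n::nat in sequentially. exp (- (2 * (s - 1) * ln n)) \<le> 1 / 2"
  proof -
    define a where "a = 2 * (s - 1)"
    have "0 < a" using s1 by (simp add: a_def)
    then have "(\<lambda>n::nat. exp (- (a * ln (real n)))) \<longlonglongrightarrow> 0"
      by real_asymp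
    then have "\<forall>\<^sub>F n::nat in sequentially. exp (- (a * ln (real n))) < 1 / 2"
      by (rule order_tendstoD) simp
    then show ?thesis
      unfolding a_def by (rule eventually_mono) simp
  qed
  have e4: "\<forall>\<^sub>F n::nat in sequentially. Q \<le> c * (ln n)\<^sup>2"
    using c0 by real_asymp
  have "\<forall>\<^sub>F n in sequentially. measure_pmf.prob (sm_model n (p n))
      {I. \<exists>M. stable_matching n I M \<and> card M + d \<le> n} \<le> ?bound n"
    using p pc e1 e2 e3 e4
  proof eventually_elim
    case (elim n)
    have n: "0 < n"
      using elim(4) by (cases n) auto
    have "c * (ln n)\<^sup>2 \<le> n * p n"
      using elim(2) n by (simp add: field_simps)
    then have "Q \<le> n * p n"
      using elim(6) by linarith
    then have "measure_pmf.prob (sm_model n (p n)) {I. \<exists>M. stable_matching n I M \<and> card M + d \<le> n}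
        \<le> 2 * exp 2 * n * ln (1 + 6 * real n) * exp (- (2 * (s - 1) * ln n)) ^ d +
          (n + 1) * (exp 2 * n * exp (- (4 * ln n)) + exp (- real n))"
      using elim \<eta> s1 c0 d by (intro prob_unmatched_le[where c=c and \<eta>=\<eta>] Q) auto
    also have "exp (- (2 * (s - 1) * ln n)) ^ d = exp (- ((1 + b) * ln n))"
      by (simp add: b_def algebra_simps flip: exp_of_nat_mult)
    finally show ?case .
  qed
  then show ?thesis
    by (intro tendsto_sandwich[OF _ _ tendsto_const lim]) auto
qed

section \<open>From stable matchings to \<open>stable_size\<close>\<close>

lemma set_pmf_sm_model:
  assumes "I \<in> set_pmf (sm_model n p)"
  obtains mp wp adm where "I = (mp, wp, adm)" "proper_prefs n mp" "proper_prefs n wp"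
proof -
  obtain mp wp adm where I: "I = (mp, wp, adm)"
    by (cases I) auto
  have "mp \<in> set_pmf (Pi_pmf {..<n} [] (\<lambda>_. uniform_list n))" "wp \<in> set_pmf (Pi_pmf {..<n} [] (\<lambda>_. uniform_list n))"
    using assms by (auto simp: I sm_model_def)
  then have "proper_prefs n mp" "proper_prefs n wp"
    by (auto simp: set_Pi_pmf PiE_dflt_def proper_prefs_def)
  then show ?thesis
    using that I by blast
qed

text \<open>On the support of the model all lists are permutations, so \<open>stable_size\<close>
  may be replaced by the size of an actual stable matching.\<close>

lemma stable_size_attained:
  assumes "I \<in> set_pmf (sm_model n p)"
  obtains M where "stable_matching n I M" "stable_size n I = card M" "card M \<le> n"
proof -
  obtain mp wp adm where I: "I = (mp, wp, adm)" "proper_prefs n mp" "proper_prefs n wp"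
    using assms by (rule set_pmf_sm_model)
  then obtain M where M: "stable_matching n I M"
    using stable_matching_exists by blast
  moreover have "stable_size n I = card M"
    using stable_size_eqI I M by blast
  moreover have "card M \<le> n"
    using M card_matching_le[of n I M] by (simp add: stable_matching_def)
  ultimately show ?thesis
    using that by blast
qed

text \<open>The events are compared on the support only, where \<open>stable_size\<close> is
  meaningful and at most \<open>n\<close>.\<close>

lemma prob_stable_size_le:
  assumes "\<And>I. I \<in> set_pmf (sm_model n p) \<Longrightarrow> P I \<Longrightarrow> stable_size n I \<le> n \<Longrightarrow> stable_size n I + d \<le> n"
  shows "measure_pmf.prob (sm_model n p) {I. P I}
    \<le> measure_pmf.prob (sm_model n p) {I. \<exists>M. stable_matching n I M \<and> card M + d \<le> n}"
proof (rule measure_pmf.finite_measure_mono_AE)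
  have "\<exists>M. stable_matching n I M \<and> card M + d \<le> n" if "I \<in> set_pmf (sm_model n p)" "P I" for I
    using stable_size_attained[OF that(1)] assms[OF that] by metis
  then show "AE I in measure_pmf (sm_model n p). I \<in> {I. P I} \<longrightarrow> I \<in> {I. \<exists>M. stable_matching n I M \<and> card M + d \<le> n}"
    by (simp add: AE_measure_pmf_iff)
qed simp

lemma stable_size_tendsto:
  fixes p :: "nat \<Rightarrow> real" and \<Delta> c :: real
  assumes p: "\<forall>\<^sub>F n in sequentially. 0 < p n \<and> p n < 1"
    and "0 < \<Delta>" and c: "(1 + 1 / (2 * \<Delta>))\<^sup>2 < c"
    and pc: "\<forall>\<^sub>F n in sequentially. p n \<ge> c * (ln (real n))\<^sup>2 / real n"
  shows "(\<lambda>n. measure_pmf.prob (sm_model n (p n)) {I. real (stable_size n I) \<le> real n - \<Delta>}) \<longlonglongrightarrow> 0"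
proof -
  \<comment> \<open>The number of singles is an integer, so at least \<open>\<Delta>\<close> means
    at least \<open>d\<close>; as \<open>d\<close> is no smaller than \<open>\<Delta>\<close>, the
    threshold for \<open>d\<close> is no larger.\<close>
  define d where "d = nat \<lceil>\<Delta>\<rceil>"
  have d: "1 \<le> d" "\<Delta> \<le> d"
    using \<open>0 < \<Delta>\<close> by (auto simp: d_def) linarith+
  have "(1 + 1 / (2 * real d))\<^sup>2 \<le> (1 + 1 / (2 * \<Delta>))\<^sup>2"
    using d \<open>0 < \<Delta>\<close> by (intro power_mono add_left_mono divide_left_mono) auto
  then have lim: "(\<lambda>n. measure_pmf.prob (sm_model n (p n)) {I. \<exists>M. stable_matching n I M \<and> card M + d \<le> n}) \<longlonglongrightarrow> 0"
    using c by (intro prob_unmatched_tendsto_0[OF d(1) _ p pc]) linarith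
  have "measure_pmf.prob (sm_model n (p n)) {I. real (stable_size n I) \<le> real n - \<Delta>}
      \<le> measure_pmf.prob (sm_model n (p n)) {I. \<exists>M. stable_matching n I M \<and> card M + d \<le> n}" for n
  proof (rule prob_stable_size_le)
    fix I assume "real (stable_size n I) \<le> real n - \<Delta>"
    then have "\<lceil>\<Delta>\<rceil> \<le> int n - int (stable_size n I)"
      by (simp add: ceiling_le_iff)
    then show "stable_size n I + d \<le> n"
      using \<open>0 < \<Delta>\<close> by (simp add: d_def) linarith
  qed
  then show ?thesis
    by (intro tendsto_sandwich[OF _ _ tendsto_const lim]) auto
qed

theorem theorem1p4:
  fixes p :: "nat \<Rightarrow> real"
  assumes "\<forall>\<^sub>F n in sequentially. 0 < p n \<and> p n < 1"
  shows "(\<forall>\<Delta> c :: real. \<Delta> > 0 \<longrightarrow> c > (1 + 1 / (2 * \<Delta>))\<^sup>2 \<longrightarrow>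
            (\<forall>\<^sub>F n in sequentially. p n \<ge> c * (ln (real n))\<^sup>2 / real n) \<longrightarrow>
            (\<lambda>n. measure_pmf.prob (sm_model n (p n))
                   {I. real (stable_size n I) \<le> real n - \<Delta>}) \<longlonglongrightarrow> 0) \<and>
         (\<forall>c :: real. c > 1 \<longrightarrow>
            (\<forall>\<^sub>F n in sequentially. p n \<ge> c * (ln (real n))\<^sup>2 / real n) \<longrightarrow>
            bounded_in_probability (\<lambda>n. sm_model n (p n))
              (\<lambda>n I. real n - real (stable_size n I))) \<and>
         (\<forall>c :: real. c > 9 / 4 \<longrightarrow>
            (\<forall>\<^sub>F n in sequentially. p n \<ge> c * (ln (real n))\<^sup>2 / real n) \<longrightarrow>
            (\<lambda>n. measure_pmf.prob (sm_model n (p n)) {I. stable_size n I = n}) \<longlonglongrightarrow> 1)"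
proof (intro conjI allI impI)
  fix \<Delta> c :: real
  assume "\<Delta> > 0" "c > (1 + 1 / (2 * \<Delta>))\<^sup>2" "\<forall>\<^sub>F n in sequentially. p n \<ge> c * (ln (real n))\<^sup>2 / real n"
  then show "(\<lambda>n. measure_pmf.prob (sm_model n (p n)) {I. real (stable_size n I) \<le> real n - \<Delta>}) \<longlonglongrightarrow> 0"
    using assms by (intro stable_size_tendsto)
next
  fix c :: real
  assume c: "c > 1" and pc: "\<forall>\<^sub>F n in sequentially. p n \<ge> c * (ln (real n))\<^sup>2 / real n"
  \<comment> \<open>With this choice \<open>1 + 1 / (2 * \<Delta>)\<close> is the midpoint of 1 and
    \<open>sqrt c\<close>.\<close>
  define \<Delta> where "\<Delta> = 1 / (sqrt c - 1)"
  have c1: "1 < sqrt c" using c by simp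
  then have \<Delta>: "0 < \<Delta>" "1 + 1 / (2 * \<Delta>) < sqrt c"
    by (auto simp: \<Delta>_def field_simps)
  then have "(1 + 1 / (2 * \<Delta>))\<^sup>2 < (sqrt c)\<^sup>2"
    by (intro power_strict_mono) auto
  then have lim: "(\<lambda>n. measure_pmf.prob (sm_model n (p n)) {I. real (stable_size n I) \<le> real n - \<Delta>}) \<longlonglongrightarrow> 0"
    using c by (intro stable_size_tendsto[OF assms \<Delta>(1) _ pc]) simp
  show "bounded_in_probability (\<lambda>n. sm_model n (p n)) (\<lambda>n I. real n - real (stable_size n I))"
    unfolding bounded_in_probability_def
  proof (intro allI impI)
    fix \<epsilon> :: real assume "\<epsilon> > 0"
    then obtain N where N: "\<And>n. n \<ge> N \<Longrightarrow> measure_pmf.prob (sm_model n (p n)) {I. real (stable_size n I) \<le> real n - \<Delta>} < \<epsilon>"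
      using order_tendstoD(2)[OF lim, of \<epsilon>] by (auto simp: eventually_sequentially)
    \<comment> \<open>The bound must hold for every \<open>n\<close>: from \<open>N\<close> on the
      limit provides it, and for \<open>n < N\<close> the event is null since at most
      \<open>n\<close> men are single.\<close>
    have "measure_pmf.prob (sm_model n (p n)) {I. \<bar>real n - real (stable_size n I)\<bar> > max \<Delta> N} \<le> \<epsilon>" for n
    proof -
      have le_n: "stable_size n I \<le> n" if "I \<in> set_pmf (sm_model n (p n))" for I
        using stable_size_attained[OF that] by metis
      show ?thesis
      proof (cases "n \<ge> N")
        case True
        have "measure_pmf.prob (sm_model n (p n)) {I. \<bar>real n - real (stable_size n I)\<bar> > max \<Delta> N}
            \<le> measure_pmf.prob (sm_model n (p n)) {I. real (stable_size n I) \<le> real n - \<Delta>}"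
          using le_n by (intro measure_pmf.finite_measure_mono_AE) (auto simp: AE_measure_pmf_iff)
        then show ?thesis
          using N[OF True] by linarith
      next
        case False
        then have "measure_pmf.prob (sm_model n (p n)) {I. \<bar>real n - real (stable_size n I)\<bar> > max \<Delta> N}
            \<le> measure_pmf.prob (sm_model n (p n)) {}"
          using le_n by (intro measure_pmf.finite_measure_mono_AE) (auto simp: AE_measure_pmf_iff)
        then show ?thesis
          using \<open>\<epsilon> > 0\<close> by simp
      qed
    qed
    then show "\<exists>K. \<forall>n. measure_pmf.prob (sm_model n (p n)) {I. \<bar>real n - real (stable_size n I)\<bar> > K} \<le> \<epsilon>"
      by blast
  qed
next
  fix c :: real
  assume c: "c > 9 / 4" and pc: "\<forall>\<^sub>F n in sequentially. p n \<ge> c * (ln (real n))\<^sup>2 / real n"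
  let ?P = "\<lambda>n. measure_pmf.prob (sm_model n (p n))"
  \<comment> \<open>The case \<open>d = 1\<close>, where the threshold is
    \<open>(3 / 2)\<^sup>2 = 9 / 4\<close>.\<close>
  have lim: "(\<lambda>n. ?P n {I. \<exists>M. stable_matching n I M \<and> card M + 1 \<le> n}) \<longlonglongrightarrow> 0"
    using c by (intro prob_unmatched_tendsto_0[OF _ _ assms pc]) (auto simp: power2_eq_square)
  have "1 - ?P n {I. \<exists>M. stable_matching n I M \<and> card M + 1 \<le> n} \<le> ?P n {I. stable_size n I = n}" for n
  proof -
    have "?P n {I. stable_size n I \<noteq> n} \<le> ?P n {I. \<exists>M. stable_matching n I M \<and> card M + 1 \<le> n}"
      by (rule prob_stable_size_le) simp
    moreover have "?P n {I. stable_size n I \<noteq> n} = 1 - ?P n {I. stable_size n I = n}"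
      using measure_pmf.prob_compl[of "{I. stable_size n I = n}" "sm_model n (p n)"]
      by (simp add: Compl_eq_Diff_UNIV[symmetric] Collect_neg_eq[symmetric])
    ultimately show ?thesis by linarith
  qed
  then have lower: "\<forall>\<^sub>F n in sequentially. 1 - ?P n {I. \<exists>M. stable_matching n I M \<and> card M + 1 \<le> n}
      \<le> ?P n {I. stable_size n I = n}"
    by (rule always_eventually[OF allI])
  have upper: "\<forall>\<^sub>F n in sequentially. ?P n {I. stable_size n I = n} \<le> 1"
    by simp
  have "(\<lambda>n. 1 - ?P n {I. \<exists>M. stable_matching n I M \<and> card M + 1 \<le> n}) \<longlonglongrightarrow> 1"
    using tendsto_diff[OF tendsto_const lim, of 1] by simp
  then show "(\<lambda>n. ?P n {I. stable_size n I = n}) \<longlonglongrightarrow> 1"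
    by (rule tendsto_sandwich[OF lower upper _ tendsto_const])
qed

end
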